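(* Let $M$ be a $3$-dimensional manifold with an ideal triangulation $K=\bigcup_{\nu=1}^N T_\nu$. Assume that $M$ has no boundary coming from $2$-skeletons on the boundary of $K$. Suppose that the simplices are decorated with spherical CR flags satisfying the face pairing compatibilities, giving a decoration $(K,z)$. Then, in $\mathcal{P}(\mathbb{C})$, $$\beta(K,z)=\beta(K,\bar z).$$ That is, $\beta(K,z)\in\mathcal{P}(\mathbb{C})^{+}$. Hence the volume of $(K,z)$ is zero.
   Context: Flags. Let $V=\mathbb{C}^3$. A flag of $\mathbb{P}(V)=\mathbb{CP}^2$ is a pair $([x],[f])\in\mathbb{P}(V)\times\mathbb{P}(V^* )$ with $f(x)=0$; $\mathrm{PGL}(3,\mathbb{C})$ acts by $A([x],[f])=([Ax],[f\circ A^{-1}])$, and configurations are orbits of ordered tuples of flags. A configuration $T=([x_i],[f_i])_{1\le i\le 4}$ is a generic tetrahedron of flags if $f_i(x_j)\ne0$ for $i\ne j$ and no three of the $[x_i]$ are collinear. Coordinates. For $i\neq j$, with $k,l$ such that $(1,2,3,4)\mapsto(i,j,k,l)$ is even, $z_{ij}(T)=\frac{f_i(x_k)\det(x_i,x_j,x_l)}{f_i(x_l)\det(x_i,x_j,x_k)}\in\mathbb{C}\setminus\{0,1\}$. For distinct $i,j,k$, $z_{ijk}(T)=\frac{f_i(x_j)f_j(x_k)f_k(x_i)}{f_i(x_k)f_j(x_i)f_k(x_j)}$. Spherical CR flags. Let $\mathbb{S}^3=\{[x,y,z]\in\mathbb{CP}^2: x\bar z+|y|^2+z\bar x=0\}$,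 the boundary of the complex hyperbolic plane $\mathbb{H}^2_{\mathbb{C}}=\{[x,y,z]: x\bar z+|y|^2+z\bar x<0\}$. A $\mathbb{C}$-circle is the boundary in $\mathbb{S}^3$ of a complex line in $\mathbb{H}^2_{\mathbb{C}}$. Each $p\in\mathbb{S}^3$ defines the flag $h(p)=(p,l_p)$, with $l_p$ the unique complex line tangent to $\mathbb{S}^3$ at $p$. Four distinct points of $\mathbb{S}^3$ are generic if no three of them lie on a $\mathbb{C}$-circle. A spherical CR tetrahedron is a tetrahedron of flags $(h(p_1),h(p_2),h(p_3),h(p_4))$ with $p_1,\dots,p_4\in\mathbb{S}^3$ generic; it is a generic tetrahedron of flags. Ideal triangulations and decorations. $K=\bigcup_{\nu=1}^N T_\nu$ is a finite union of oriented $3$-simplices with identifications of faces in pairs by orientation-reversing simplicial maps (identifications on the boundary of a single simplex are allowed). The compact oriented $3$-manifold $M$ with boundary is a retract of $|K|-|K^{(0)}|$. "No boundary coming from $2$-skeletons on the boundary of $K$" means that all $2$-faces of all the $T_\nu$ are glued in pairs. The vertices of each $T_\nu$ are ordered as $1,2,3,4$ compatibly with its orientation. "Decorated with spherical CR flags" means that flags are assigned to the vertices of each $T_\nu$ so that the four flags form a spherical CR tetrahedron (also denoted $T_\nu$); $z=(z_{ij}(T_\nu))$ denotes the resulting coordinates. Face pairing compatibilities: if $T,T'$ share a face $(ijk)$, oriented as a boundary face of $T$, then $z_{ijk}(T)z_{ikj}(T')=1$. The conjugate decoration $(K,\bar z)$ is obtained by complex conjugating all homogeneous coordinates of all flags;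 its coordinates are the $\overline{z_{ij}(T_\nu)}$. Invariants. $\mathcal{P}(\mathbb{C})$ is the quotient of $\mathbb{Z}[\mathbb{C}\setminus\{0,1\}]$ by the subgroup generated by $[x]-[y]+[\frac yx]-[\frac{1-x^{-1}}{1-y^{-1}}]+[\frac{1-x}{1-y}]$, $x\ne y$. Complex conjugation induces an involution $\tau$ on it, and $\mathcal{P}(\mathbb{C})^+=\{u:\tau(u)=u\}$. Then $\beta(K,z)=\sum_{\nu=1}^N\big([z_{12}(T_\nu)]+[z_{21}(T_\nu)]+[z_{34}(T_\nu)]+[z_{43}(T_\nu)]\big)$. The volume of $(K,z)$ is $\frac14 D(\beta(K,z))$, where $D:\mathcal{P}(\mathbb{C})\to\mathbb{R}$ is induced linearly by the Bloch–Wigner dilogarithm $D(x)=\arg(1-x)\log|x|-\mathrm{Im}\int_0^x\log(1-t)\frac{dt}{t}$. *)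

theory Defs
  imports
    "HOL-Complex_Analysis.Complex_Analysis"
    "HOL-Algebra.Algebra"
    "HOL-Combinatorics.Permutations"
begin

unbundle no fps_syntax  (* \<open>$\<close> is vector indexing *)

section \<open>The complex projective plane and flags\<close>

text \<open>The dual space \<open>V\<^sup>*\<close> is identified with \<open>complex^3\<close> through the dual of the standard basis, so
  that \<open>f(x)\<close> is \<^term>\<open>scalar_product f x\<close> (bilinear, no conjugation).  With this identification
  the same type serves for \<open>P(V)\<close> and \<open>P(V\<^sup>*)\<close>.\<close>

definition proj_rel :: "complex^3 \<Rightarrow> complex^3 \<Rightarrow> bool" where
  "proj_rel x y \<longleftrightarrow> x \<noteq> 0 \<and> y \<noteq> 0 \<and> (\<exists>c. c \<noteq> 0 \<and> y = c *s x)"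

lemma proj_rel_part_equivp: "part_equivp proj_rel"
proof (rule part_equivpI)
  have "(1::complex^3) \<noteq> 0"
    by (metis one_index zero_index zero_neq_one)
  then have "proj_rel 1 1"
    unfolding proj_rel_def by (metis vector_smult_lid zero_neq_one)
  then show "\<exists>x. proj_rel x x" by blast
  show "symp proj_rel"
  proof (rule sympI)
    fix x y :: "complex^3"
    assume "proj_rel x y"
    then obtain c where "x \<noteq> 0" "y \<noteq> 0" "c \<noteq> 0" "y = c *s x"
      unfolding proj_rel_def by blast
    moreover from this have "x = inverse c *s y" "inverse c \<noteq> 0"
      by (simp_all add: vector_smult_assoc)
    ultimately show "proj_rel y x"
      unfolding proj_rel_def by blast
  qed
  show "transp proj_rel"
  proof (rule transpI)
    fix x y z :: "complex^3"
    assume "proj_rel x y" "proj_rel y z"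
    then obtain c d where "x \<noteq> 0" "z \<noteq> 0" "c \<noteq> 0" "y = c *s x" "d \<noteq> 0" "z = d *s y"
      unfolding proj_rel_def by blast
    moreover from this have "z = (d * c) *s x" "d * c \<noteq> 0"
      by (simp_all add: vector_smult_assoc)
    ultimately show "proj_rel x z"
      unfolding proj_rel_def by blast
  qed
qed

quotient_type cp2 = "complex^3" / partial: proj_rel
  by (rule proj_rel_part_equivp)

type_synonym dual_cp2 = cp2
type_synonym flag = "cp2 \<times> dual_cp2"

definition incident :: "cp2 \<Rightarrow> dual_cp2 \<Rightarrow> bool" where
  "incident p l \<longleftrightarrow> scalar_product (rep_cp2 l) (rep_cp2 p) = 0"

definition is_flag :: "flag \<Rightarrow> bool" where
  "is_flag F \<longleftrightarrow> incident (fst F) (snd F)"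

definition cnj_vec :: "complex^3 \<Rightarrow> complex^3" where
  "cnj_vec v = (\<chi> i. cnj (v $ i))"

lift_definition conj_cp2 :: "cp2 \<Rightarrow> cp2" is cnj_vec
  unfolding proj_rel_def
proof (elim conjE exE, intro conjI)
  fix x y :: "complex^3" and c
  assume *: "x \<noteq> 0" "y \<noteq> 0" "c \<noteq> 0" "y = c *s x"
  show "cnj_vec x \<noteq> 0" "cnj_vec y \<noteq> 0"
    using *(1,2) by (auto simp: cnj_vec_def vec_eq_iff)
  have "cnj_vec y = cnj c *s cnj_vec x" "cnj c \<noteq> 0"
    using * by (auto simp: cnj_vec_def vec_eq_iff)
  then show "\<exists>c. c \<noteq> 0 \<and> cnj_vec y = c *s cnj_vec x" by blast
qed

definition conj_flag :: "flag \<Rightarrow> flag" where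
  "conj_flag F = (conj_cp2 (fst F), conj_cp2 (snd F))"

lemma rep_cp2_nonzero: "rep_cp2 p \<noteq> 0"
  using Quotient_rep_reflp[OF Quotient_cp2, of p] by (simp add: proj_rel_def)

lemma abs_rep_cp2: "abs_cp2 (rep_cp2 p) = p"
  by (rule Quotient_abs_rep[OF Quotient_cp2])

lemma abs_cp2_eq_iff:
  assumes "x \<noteq> 0" "y \<noteq> 0"
  shows "abs_cp2 x = abs_cp2 y \<longleftrightarrow> (\<exists>c. c \<noteq> 0 \<and> y = c *s x)"
proof -
  have refl: "proj_rel v v" if "v \<noteq> 0" for v
    using that unfolding proj_rel_def by (metis vector_smult_lid zero_neq_one)
  show ?thesis
    using Quotient_rel[OF Quotient_cp2, of x y] refl assms by (auto simp: proj_rel_def)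
qed

lemma rep_abs_cp2:
  assumes "x \<noteq> 0"
  obtains c where "c \<noteq> 0" "rep_cp2 (abs_cp2 x) = c *s x"
  using abs_cp2_eq_iff[OF assms rep_cp2_nonzero, of "abs_cp2 x"] abs_rep_cp2 by metis


section \<open>Coordinates of a tetrahedron of flags\<close>

text \<open>The vertices of a tetrahedron are the elements \<open>1, 2, 3, 4\<close> of the four-element type \<open>4\<close>
  (in which \<open>4 = 0\<close>).\<close>

definition even_order :: "4 \<Rightarrow> 4 \<Rightarrow> 4 \<Rightarrow> 4 \<Rightarrow> bool" where
  "even_order i j k l \<longleftrightarrow>
     (\<exists>p. p permutes UNIV \<and> evenperm p \<and> p 1 = i \<and> p 2 = j \<and> p 3 = k \<and> p 4 = l)"

text \<open>In both coordinates below every homogeneous vector occurs with the same multiplicity in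
  numerator and denominator, so the choice of representatives does not matter (see the lemmas
  \<open>z_edge_reps\<close> and \<open>z_face_reps\<close>).\<close>

definition z_edge :: "(4 \<Rightarrow> flag) \<Rightarrow> 4 \<Rightarrow> 4 \<Rightarrow> complex" where
  "z_edge T i j =
     (let (k, l) = (THE (k, l). even_order i j k l);
          x = (\<lambda>m. rep_cp2 (fst (T m)));
          f = (\<lambda>m. rep_cp2 (snd (T m)))
      in (scalar_product (f i) (x k) * det (vector [x i, x j, x l] :: complex^3^3)) /
         (scalar_product (f i) (x l) * det (vector [x i, x j, x k] :: complex^3^3)))"

definition z_face :: "(4 \<Rightarrow> flag) \<Rightarrow> 4 \<Rightarrow> 4 \<Rightarrow> 4 \<Rightarrow> complex" where
  "z_face T i j k =
     (let x = (\<lambda>m. rep_cp2 (fst (T m)));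
          f = (\<lambda>m. rep_cp2 (snd (T m)))
      in (scalar_product (f i) (x j) * scalar_product (f j) (x k) * scalar_product (f k) (x i)) /
         (scalar_product (f i) (x k) * scalar_product (f j) (x i) * scalar_product (f k) (x j)))"


section \<open>Spherical CR flags\<close>

text \<open>The argument of \<^const>\<open>Re\<close> is already real.\<close>

definition hform :: "complex^3 \<Rightarrow> real" where
  "hform v = Re (v $ 1 * cnj (v $ 3) + of_real ((cmod (v $ 2))\<^sup>2) + v $ 3 * cnj (v $ 1))"

definition S3 :: "cp2 set" where
  "S3 = {p. hform (rep_cp2 p) = 0}"

definition H2C :: "cp2 set" where
  "H2C = {p. hform (rep_cp2 p) < 0}"

text \<open>A complex line of \<^const>\<open>H2C\<close> is the nonempty intersection of \<^const>\<open>H2C\<close> with a projective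
  line, and its boundary is the intersection of that projective line with \<^const>\<open>S3\<close>.\<close>

definition is_C_circle :: "cp2 set \<Rightarrow> bool" where
  "is_C_circle C \<longleftrightarrow>
     (\<exists>l. {p \<in> H2C. incident p l} \<noteq> {} \<and> C = {p \<in> S3. incident p l})"

text \<open>Tangency is expressed on the cones in \<open>complex^3\<close>: the plane over the line \<open>l\<close> is contained in
  the tangent space of the hypersurface \<open>hform = 0\<close> at a representative of \<open>p\<close>.\<close>

definition tangent_S3 :: "dual_cp2 \<Rightarrow> cp2 \<Rightarrow> bool" where
  "tangent_S3 l p \<longleftrightarrow> incident p l \<and>
     (\<forall>v. scalar_product (rep_cp2 l) v = 0 \<longrightarrow>
        ((\<lambda>t. hform (rep_cp2 p + t *\<^sub>R v)) has_real_derivative 0) (at 0))"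

definition tangent_line :: "cp2 \<Rightarrow> dual_cp2" where
  "tangent_line p = (THE l. tangent_S3 l p)"

definition CR_flag :: "cp2 \<Rightarrow> flag" where
  "CR_flag p = (p, tangent_line p)"

definition generic_points :: "(4 \<Rightarrow> cp2) \<Rightarrow> bool" where
  "generic_points p \<longleftrightarrow> range p \<subseteq> S3 \<and> inj p \<and>
     (\<forall>i j k. i \<noteq> j \<and> j \<noteq> k \<and> i \<noteq> k \<longrightarrow> \<not> (\<exists>C. is_C_circle C \<and> {p i, p j, p k} \<subseteq> C))"

definition spherical_CR_tetrahedron :: "(4 \<Rightarrow> flag) \<Rightarrow> bool" where
  "spherical_CR_tetrahedron T \<longleftrightarrow> (\<exists>p. generic_points p \<and> T = (\<lambda>i. CR_flag (p i)))"


section \<open>Ideal triangulations and decorations\<close>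

text \<open>The simplices are indexed by \<open>{1..num_simplices K}\<close>, and \<open>(\<nu>, v)\<close> denotes the face of the
  \<open>\<nu>\<close>-th simplex opposite to its vertex \<open>v\<close>.  An entry \<open>pairing K (\<nu>, v) = Some (\<nu>', \<sigma>)\<close> glues this
  face to the face \<open>(\<nu>', \<sigma> v)\<close> by the simplicial map sending the vertex \<open>i \<noteq> v\<close> to \<open>\<sigma> i\<close>; the value
  \<open>\<sigma> v\<close> merely records the opposite vertex of the target.  As the vertices of each simplex are
  ordered compatibly with its orientation, the map of (boundary oriented) faces reverses
  orientation iff \<open>\<sigma>\<close> is odd.  A face absent from the domain is a boundary face.
  The manifold (a compact retract of the realization minus its vertices) is determined by these
  data.\<close>

record face_gluing =
  num_simplices :: nat
  pairing :: "nat \<times> 4 \<rightharpoonup> nat \<times> (4 \<Rightarrow> 4)"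

definition simplices :: "face_gluing \<Rightarrow> nat set" where
  "simplices K = {1..num_simplices K}"

definition ideal_triangulation :: "face_gluing \<Rightarrow> bool" where
  "ideal_triangulation K \<longleftrightarrow>
     dom (pairing K) \<subseteq> simplices K \<times> UNIV \<and>
     (\<forall>\<nu> v \<nu>' \<sigma>. pairing K (\<nu>, v) = Some (\<nu>', \<sigma>) \<longrightarrow>
        \<nu>' \<in> simplices K \<and> \<sigma> permutes UNIV \<and> \<not> evenperm \<sigma> \<and>
        (\<nu>', \<sigma> v) \<noteq> (\<nu>, v) \<and> pairing K (\<nu>', \<sigma> v) = Some (\<nu>, inv_into UNIV \<sigma>))"

definition no_boundary_faces :: "face_gluing \<Rightarrow> bool" where
  "no_boundary_faces K \<longleftrightarrow> dom (pairing K) = simplices K \<times> UNIV"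

type_synonym decoration = "nat \<Rightarrow> 4 \<Rightarrow> flag"
type_synonym edge_coords = "nat \<Rightarrow> 4 \<Rightarrow> 4 \<Rightarrow> complex"

definition CR_decoration :: "face_gluing \<Rightarrow> decoration \<Rightarrow> bool" where
  "CR_decoration K T \<longleftrightarrow> (\<forall>\<nu>\<in>simplices K. spherical_CR_tetrahedron (T \<nu>))"

text \<open>\<open>even_order v i j k\<close> says that \<open>(ijk)\<close> is the boundary orientation of the face opposite to
  \<open>v\<close>; for the opposite order both factors are replaced by their inverses, so the other convention
  gives the same condition.\<close>

definition face_compatible :: "face_gluing \<Rightarrow> decoration \<Rightarrow> bool" where
  "face_compatible K T \<longleftrightarrow>
     (\<forall>\<nu> v \<nu>' \<sigma> i j k. pairing K (\<nu>, v) = Some (\<nu>', \<sigma>) \<and> even_order v i j k \<longrightarrow>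
        z_face (T \<nu>) i j k * z_face (T \<nu>') (\<sigma> i) (\<sigma> k) (\<sigma> j) = 1)"

definition conj_decoration :: "decoration \<Rightarrow> decoration" where
  "conj_decoration T = (\<lambda>\<nu> i. conj_flag (T \<nu> i))"

definition coords :: "decoration \<Rightarrow> edge_coords" where
  "coords T = (\<lambda>\<nu> i j. z_edge (T \<nu>) i j)"


section \<open>The pre-Bloch group\<close>

definition frag_group :: "(complex \<Rightarrow>\<^sub>0 int) monoid" where
  "frag_group = free_Abelian_group (UNIV - {0, 1})"

definition five_term :: "complex \<Rightarrow> complex \<Rightarrow> (complex \<Rightarrow>\<^sub>0 int)" where
  "five_term x y = frag_of x - frag_of y + frag_of (y / x)
     - frag_of ((1 - inverse x) / (1 - inverse y)) + frag_of ((1 - x) / (1 - y))"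

definition five_term_subgroup :: "(complex \<Rightarrow>\<^sub>0 int) set" where
  "five_term_subgroup = generate frag_group
     {five_term x y | x y. x \<in> UNIV - {0, 1} \<and> y \<in> UNIV - {0, 1} \<and> x \<noteq> y}"

definition pre_Bloch :: "(complex \<Rightarrow>\<^sub>0 int) set monoid" where
  "pre_Bloch = frag_group Mod five_term_subgroup"

definition pre_Bloch_class :: "(complex \<Rightarrow>\<^sub>0 int) \<Rightarrow> (complex \<Rightarrow>\<^sub>0 int) set" where
  "pre_Bloch_class c = five_term_subgroup #>\<^bsub>frag_group\<^esub> c"

definition conj_frag :: "(complex \<Rightarrow>\<^sub>0 int) \<Rightarrow> (complex \<Rightarrow>\<^sub>0 int)" where
  "conj_frag = frag_extend (\<lambda>x. frag_of (cnj x))"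

text \<open>Elements of \<^const>\<open>pre_Bloch\<close> are cosets; conjugation acts on them by taking images.\<close>

definition tau :: "(complex \<Rightarrow>\<^sub>0 int) set \<Rightarrow> (complex \<Rightarrow>\<^sub>0 int) set" where
  "tau u = conj_frag ` u"

definition pre_Bloch_plus :: "(complex \<Rightarrow>\<^sub>0 int) set set" where
  "pre_Bloch_plus = {u \<in> carrier pre_Bloch. tau u = u}"

definition beta :: "face_gluing \<Rightarrow> edge_coords \<Rightarrow> (complex \<Rightarrow>\<^sub>0 int) set" where
  "beta K z = pre_Bloch_class
     (\<Sum>\<nu>\<in>simplices K. frag_of (z \<nu> 1 2) + frag_of (z \<nu> 2 1) + frag_of (z \<nu> 3 4) + frag_of (z \<nu> 4 3))"

text \<open>Principal branches and the straight path from \<open>0\<close> to \<open>x\<close>.  For real \<open>x > 1\<close> the path meets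
  the branch cut; there \<open>Ln (1 - t)\<close> and \<open>Arg (1 - x)\<close> both take the boundary values with imaginary
  part \<open>pi\<close>, and the two terms cancel, as they should (the function vanishes on the reals).\<close>

definition Bloch_Wigner :: "complex \<Rightarrow> real" where
  "Bloch_Wigner x = Arg (1 - x) * ln (cmod x)
     - Im (contour_integral (linepath 0 x) (\<lambda>t. Ln (1 - t) / t))"

definition Bloch_Wigner_frag :: "(complex \<Rightarrow>\<^sub>0 int) \<Rightarrow> real" where
  "Bloch_Wigner_frag c = (\<Sum>x\<in>Poly_Mapping.keys c. of_int (Poly_Mapping.lookup c x) * Bloch_Wigner x)"

text \<open>The induced map: the common value of \<^const>\<open>Bloch_Wigner_frag\<close> on a coset.\<close>

definition Bloch_Wigner_class :: "(complex \<Rightarrow>\<^sub>0 int) set \<Rightarrow> real" where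
  "Bloch_Wigner_class u = the_elem (Bloch_Wigner_frag ` u)"

definition tri_volume :: "face_gluing \<Rightarrow> edge_coords \<Rightarrow> real" where
  "tri_volume K z = 1 / 4 * Bloch_Wigner_class (beta K z)"


section \<open>The definitions in terms of arbitrary representatives\<close>

lemma abs_cp2_exhaust:
  obtains v where "v \<noteq> 0" "p = abs_cp2 v"
  using rep_cp2_nonzero abs_rep_cp2 by metis

definition perm4 :: "4 \<Rightarrow> 4 \<Rightarrow> 4 \<Rightarrow> 4 \<Rightarrow> 4 \<Rightarrow> 4" where
  "perm4 i j k l = (\<lambda>m. if m = 1 then i else if m = 2 then j else if m = 3 then k else l)"

lemma neq4: "(1::4) \<noteq> 2" "(1::4) \<noteq> 3" "(1::4) \<noteq> 4" "(2::4) \<noteq> 3" "(2::4) \<noteq> 4" "(3::4) \<noteq> 4"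
  by simp_all

lemma perm4_permutes:
  assumes "distinct [i, j, k, l]"
  shows "perm4 i j k l permutes UNIV"
proof -
  have "\<forall>a b. perm4 i j k l a = perm4 i j k l b \<longrightarrow> a = b"
    using assms unfolding forall_4 by (simp add: perm4_def eq_commute)
  then have "inj (perm4 i j k l)"
    by (simp add: inj_def)
  then have "bij (perm4 i j k l)"
    by (simp add: bij_def finite_UNIV_inj_surj)
  then show ?thesis by (rule bij_imp_permutes) simp
qed

lemma perm4_swap:
  assumes "distinct [i, j, k, l]"
  shows "evenperm (perm4 j i k l) \<longleftrightarrow> \<not> evenperm (perm4 i j k l)"
    and "evenperm (perm4 i k j l) \<longleftrightarrow> \<not> evenperm (perm4 i j k l)"
    and "evenperm (perm4 i j l k) \<longleftrightarrow> \<not> evenperm (perm4 i j k l)"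
proof -
  have p: "permutation (perm4 i j k l)"
    using perm4_permutes[OF assms] by (auto simp: permutation_permutes)
  have t: "evenperm (perm4 i j k l \<circ> Transposition.transpose a b) \<longleftrightarrow> \<not> evenperm (perm4 i j k l)" if "a \<noteq> b" for a b
    using that evenperm_comp[OF p permutation_swap_id[of a b]] by (simp add: evenperm_swap)
  have "perm4 j i k l = perm4 i j k l \<circ> Transposition.transpose 1 2"
       "perm4 i k j l = perm4 i j k l \<circ> Transposition.transpose 2 3"
       "perm4 i j l k = perm4 i j k l \<circ> Transposition.transpose 3 4"
    by (simp_all add: fun_eq_iff forall_4 perm4_def Transposition.transpose_def)
  with t show "evenperm (perm4 j i k l) \<longleftrightarrow> \<not> evenperm (perm4 i j k l)"
    "evenperm (perm4 i k j l) \<longleftrightarrow> \<not> evenperm (perm4 i j k l)"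
    "evenperm (perm4 i j l k) \<longleftrightarrow> \<not> evenperm (perm4 i j k l)"
    by simp_all
qed

lemma perm4_id: "perm4 1 2 3 4 = id"
  by (simp add: fun_eq_iff forall_4 perm4_def)

lemma even_order_perm4:
  "even_order i j k l \<longleftrightarrow> distinct [i, j, k, l] \<and> evenperm (perm4 i j k l)"
proof
  assume "even_order i j k l"
  then obtain p where p: "p permutes UNIV" "evenperm p" "p 1 = i" "p 2 = j" "p 3 = k" "p 4 = l"
    unfolding even_order_def by blast
  have "p = perm4 i j k l"
    using p(3-6) by (simp add: fun_eq_iff forall_4 perm4_def)
  with p(2) have "evenperm (perm4 i j k l)" by simp
  moreover have inj: "inj p" using p(1) by (rule permutes_inj)
  have "distinct [i, j, k, l]"
    unfolding p(3-6)[symmetric] by (simp add: inj_eq[OF inj])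
  ultimately show "distinct [i, j, k, l] \<and> evenperm (perm4 i j k l)"
    by blast
next
  assume *: "distinct [i, j, k, l] \<and> evenperm (perm4 i j k l)"
  then have "perm4 i j k l permutes UNIV" by (intro perm4_permutes) simp
  with * show "even_order i j k l"
    unfolding even_order_def by (intro exI[of _ "perm4 i j k l"]) (simp add: perm4_def)
qed

lemma even_order_iff:
  "even_order i j k l \<longleftrightarrow> (i, j, k, l) \<in>
     {(1,2,3,4), (1,3,4,2), (1,4,2,3), (2,1,4,3), (2,3,1,4), (2,4,3,1),
      (3,1,2,4), (3,2,4,1), (3,4,1,2), (4,1,3,2), (4,2,1,3), (4,3,2,1)}"
proof -
  have e1234: "evenperm (perm4 1 2 3 4) \<longleftrightarrow> True" by (simp add: perm4_id)
  have e2134: "evenperm (perm4 2 1 3 4) \<longleftrightarrow> False"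
    using perm4_swap(1)[of 1 2 3 4] by (simp add: e1234)
  have e1324: "evenperm (perm4 1 3 2 4) \<longleftrightarrow> False"
    using perm4_swap(2)[of 1 2 3 4] by (simp add: e1234)
  have e1243: "evenperm (perm4 1 2 4 3) \<longleftrightarrow> False"
    using perm4_swap(3)[of 1 2 3 4] by (simp add: e1234)
  have e2314: "evenperm (perm4 2 3 1 4) \<longleftrightarrow> True"
    using perm4_swap(2)[of 2 1 3 4] by (simp add: e2134)
  have e2143: "evenperm (perm4 2 1 4 3) \<longleftrightarrow> True"
    using perm4_swap(3)[of 2 1 3 4] by (simp add: e2134)
  have e3124: "evenperm (perm4 3 1 2 4) \<longleftrightarrow> True"
    using perm4_swap(1)[of 1 3 2 4] by (simp add: e1324)
  have e1342: "evenperm (perm4 1 3 4 2) \<longleftrightarrow> True"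
    using perm4_swap(3)[of 1 3 2 4] by (simp add: e1324)
  have e1423: "evenperm (perm4 1 4 2 3) \<longleftrightarrow> True"
    using perm4_swap(2)[of 1 2 4 3] by (simp add: e1243)
  have e3214: "evenperm (perm4 3 2 1 4) \<longleftrightarrow> False"
    using perm4_swap(1)[of 2 3 1 4] by (simp add: e2314)
  have e2341: "evenperm (perm4 2 3 4 1) \<longleftrightarrow> False"
    using perm4_swap(3)[of 2 3 1 4] by (simp add: e2314)
  have e2413: "evenperm (perm4 2 4 1 3) \<longleftrightarrow> False"
    using perm4_swap(2)[of 2 1 4 3] by (simp add: e2143)
  have e3142: "evenperm (perm4 3 1 4 2) \<longleftrightarrow> False"
    using perm4_swap(3)[of 3 1 2 4] by (simp add: e3124)
  have e1432: "evenperm (perm4 1 4 3 2) \<longleftrightarrow> False"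
    using perm4_swap(2)[of 1 3 4 2] by (simp add: e1342)
  have e4123: "evenperm (perm4 4 1 2 3) \<longleftrightarrow> False"
    using perm4_swap(1)[of 1 4 2 3] by (simp add: e1423)
  have e3241: "evenperm (perm4 3 2 4 1) \<longleftrightarrow> True"
    using perm4_swap(3)[of 3 2 1 4] by (simp add: e3214)
  have e2431: "evenperm (perm4 2 4 3 1) \<longleftrightarrow> True"
    using perm4_swap(2)[of 2 3 4 1] by (simp add: e2341)
  have e4213: "evenperm (perm4 4 2 1 3) \<longleftrightarrow> True"
    using perm4_swap(1)[of 2 4 1 3] by (simp add: e2413)
  have e3412: "evenperm (perm4 3 4 1 2) \<longleftrightarrow> True"
    using perm4_swap(2)[of 3 1 4 2] by (simp add: e3142)
  have e4132: "evenperm (perm4 4 1 3 2) \<longleftrightarrow> True"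
    using perm4_swap(1)[of 1 4 3 2] by (simp add: e1432)
  have e3421: "evenperm (perm4 3 4 2 1) \<longleftrightarrow> False"
    using perm4_swap(2)[of 3 2 4 1] by (simp add: e3241)
  have e4231: "evenperm (perm4 4 2 3 1) \<longleftrightarrow> False"
    using perm4_swap(1)[of 2 4 3 1] by (simp add: e2431)
  have e4312: "evenperm (perm4 4 3 1 2) \<longleftrightarrow> False"
    using perm4_swap(1)[of 3 4 1 2] by (simp add: e3412)
  have e4321: "evenperm (perm4 4 3 2 1) \<longleftrightarrow> True"
    using perm4_swap(1)[of 3 4 2 1] by (simp add: e3421)
  note e = e1234 e2134 e1324 e1243 e2314 e2143 e3124 e1342 e1423 e3214 e2341 e2413 e3142 e1432 e4123 e3241 e2431 e4213 e3412 e4132 e3421 e4231 e4312 e4321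
  show ?thesis
    using exhaust_4[of i] exhaust_4[of j] exhaust_4[of k] exhaust_4[of l]
    by (elim disjE; hypsubst_thin; simp add: even_order_perm4 e)
qed

lemma the_even_order:
  assumes "even_order i j k l"
  shows "(THE (k, l). even_order i j k l) = (k, l)"
proof (rule the_equality)
  have unique: "k' = k \<and> l' = l" if "even_order i j k' l'" for k' l'
    using assms that unfolding even_order_iff by (elim insertE emptyE; simp)
  then show "kl = (k, l)" if "case kl of (k, l) \<Rightarrow> even_order i j k l" for kl
    using that by (cases kl) simp
qed (simp add: assms)

lemma scalar_product_3: "scalar_product f (x::complex^3) = f $ 1 * x $ 1 + f $ 2 * x $ 2 + f $ 3 * x $ 3"
  by (simp add: scalar_product_def sum_3)

lemma z_edge_reps:
  assumes "even_order i j k l"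
    and "\<And>m. x m \<noteq> 0" "\<And>m. f m \<noteq> 0"
  shows "z_edge (\<lambda>m. (abs_cp2 (x m), abs_cp2 (f m))) i j =
     (scalar_product (f i) (x k) * det (vector [x i, x j, x l] :: complex^3^3)) /
     (scalar_product (f i) (x l) * det (vector [x i, x j, x k] :: complex^3^3))"
proof -
  have "\<exists>c. c \<noteq> 0 \<and> rep_cp2 (abs_cp2 (x m)) = c *s x m" for m
    using rep_abs_cp2[OF assms(2)] by metis
  then obtain a where a: "\<And>m. a m \<noteq> 0" "\<And>m. rep_cp2 (abs_cp2 (x m)) = a m *s x m" by metis
  have "\<exists>c. c \<noteq> 0 \<and> rep_cp2 (abs_cp2 (f m)) = c *s f m" for m
    using rep_abs_cp2[OF assms(3)] by metis
  then obtain b where b: "\<And>m. b m \<noteq> 0" "\<And>m. rep_cp2 (abs_cp2 (f m)) = b m *s f m" by metis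
  have sp: "scalar_product (b p *s f p) (a q *s x q) = b p * a q * scalar_product (f p) (x q)" for p q
    by (simp add: scalar_product_3 algebra_simps)
  have dt: "det (vector [a p *s x p, a q *s x q, a r *s x r] :: complex^3^3)
    = a p * a q * a r * det (vector [x p, x q, x r] :: complex^3^3)" for p q r
    by (simp add: det_3 algebra_simps)
  show ?thesis
    using a(1) b(1)
    by (simp add: z_edge_def Let_def the_even_order[OF assms(1)] a(2) b(2) sp dt)
qed

lemma z_face_reps:
  assumes "\<And>m. x m \<noteq> 0" "\<And>m. f m \<noteq> 0"
  shows "z_face (\<lambda>m. (abs_cp2 (x m), abs_cp2 (f m))) i j k =
     (scalar_product (f i) (x j) * scalar_product (f j) (x k) * scalar_product (f k) (x i)) /
     (scalar_product (f i) (x k) * scalar_product (f j) (x i) * scalar_product (f k) (x j))"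
proof -
  have "\<exists>c. c \<noteq> 0 \<and> rep_cp2 (abs_cp2 (x m)) = c *s x m" for m
    using rep_abs_cp2[OF assms(1)] by metis
  then obtain a where a: "\<And>m. a m \<noteq> 0" "\<And>m. rep_cp2 (abs_cp2 (x m)) = a m *s x m" by metis
  have "\<exists>c. c \<noteq> 0 \<and> rep_cp2 (abs_cp2 (f m)) = c *s f m" for m
    using rep_abs_cp2[OF assms(2)] by metis
  then obtain b where b: "\<And>m. b m \<noteq> 0" "\<And>m. rep_cp2 (abs_cp2 (f m)) = b m *s f m" by metis
  have sp: "scalar_product (b p *s f p) (a q *s x q) = b p * a q * scalar_product (f p) (x q)" for p q
    by (simp add: scalar_product_3 algebra_simps)
  show ?thesis
    using a(1) b(1)
    by (simp add: z_face_def a(2) b(2) sp mult.assoc)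
qed

lemma conj_cp2_abs:
  assumes "v \<noteq> 0"
  shows "conj_cp2 (abs_cp2 v) = abs_cp2 (cnj_vec v)"
proof -
  have "proj_rel v v" using assms unfolding proj_rel_def by (metis vector_smult_lid zero_neq_one)
  then show ?thesis by (rule conj_cp2.abs_eq)
qed

lemma cnj_vec_nonzero: "v \<noteq> 0 \<Longrightarrow> cnj_vec v \<noteq> 0"
  by (auto simp: cnj_vec_def vec_eq_iff)

lemma z_edge_conj:
  assumes "even_order i j k l"
  shows "z_edge (\<lambda>m. conj_flag (T m)) i j = cnj (z_edge T i j)"
proof -
  define x where "x = (\<lambda>m. rep_cp2 (fst (T m)))"
  define f where "f = (\<lambda>m. rep_cp2 (snd (T m)))"
  have nz: "x m \<noteq> 0" "f m \<noteq> 0" for m by (simp_all add: x_def f_def rep_cp2_nonzero)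
  have T: "T = (\<lambda>m. (abs_cp2 (x m), abs_cp2 (f m)))"
    by (simp add: x_def f_def abs_rep_cp2)
  have sp: "scalar_product (cnj_vec v) (cnj_vec w) = cnj (scalar_product v w)" for v w
    by (simp add: scalar_product_3 cnj_vec_def)
  have dt: "det (vector [cnj_vec u, cnj_vec v, cnj_vec w] :: complex^3^3)
    = cnj (det (vector [u, v, w] :: complex^3^3))" for u v w
    by (simp add: det_3 cnj_vec_def)
  have "(\<lambda>m. conj_flag (T m)) = (\<lambda>m. (abs_cp2 (cnj_vec (x m)), abs_cp2 (cnj_vec (f m))))"
    by (simp add: T conj_flag_def conj_cp2_abs nz)
  then show ?thesis
    by (simp add: z_edge_reps[OF assms] cnj_vec_nonzero nz sp dt) (simp add: T z_edge_reps[OF assms] nz)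
qed

lemma hform_smult: "hform (c *s v) = (cmod c)\<^sup>2 * hform v"
proof -
  have c2: "(cmod c)\<^sup>2 = Re c * Re c + Im c * Im c" by (simp add: cmod_power2 flip: power2_eq_square)
  show ?thesis
    by (simp add: hform_def norm_mult power_mult_distrib c2) (simp add: algebra_simps)
qed

lemma S3_abs_iff: "v \<noteq> 0 \<Longrightarrow> abs_cp2 v \<in> S3 \<longleftrightarrow> hform v = 0"
  by (erule rep_abs_cp2[of v]) (auto simp: S3_def hform_smult)

lemma H2C_abs_iff: "v \<noteq> 0 \<Longrightarrow> abs_cp2 v \<in> H2C \<longleftrightarrow> hform v < 0"
  by (erule rep_abs_cp2[of v]) (auto simp: H2C_def hform_smult mult_less_0_iff)

lemma incident_abs_iff:
  assumes "v \<noteq> 0" "f \<noteq> 0"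
  shows "incident (abs_cp2 v) (abs_cp2 f) \<longleftrightarrow> scalar_product f v = 0"
proof -
  obtain c where c: "c \<noteq> 0" "rep_cp2 (abs_cp2 v) = c *s v" by (rule rep_abs_cp2[OF assms(1)])
  obtain d where d: "d \<noteq> 0" "rep_cp2 (abs_cp2 f) = d *s f" by (rule rep_abs_cp2[OF assms(2)])
  have "scalar_product (d *s f) (c *s v) = d * c * scalar_product f v"
    by (simp add: scalar_product_3 algebra_simps)
  with c d show ?thesis by (simp add: incident_def)
qed

text \<open>The covector of the Hermitian form, so that \<open>hform v = Re (polar v v)\<close>.\<close>

definition polar :: "complex^3 \<Rightarrow> complex^3" where
  "polar v = vector [cnj (v $ 3), cnj (v $ 2), cnj (v $ 1)]"

lemma hform_polar: "hform v = Re (scalar_product (polar v) v)"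
  by (simp add: hform_def scalar_product_3 polar_def cmod_power2) (simp add: power2_eq_square)

lemma polar_nonzero: "v \<noteq> 0 \<Longrightarrow> polar v \<noteq> 0"
  by (auto simp: polar_def vec_eq_iff forall_3)

lemma hform_deriv:
  "((\<lambda>t. hform (x + t *\<^sub>R v)) has_real_derivative 2 * Re (scalar_product (polar x) v)) (at 0)"
proof -
  have eq: "hform (x + t *\<^sub>R v) = hform x + t * (2 * Re (scalar_product (polar x) v)) + t\<^sup>2 * hform v" for t
    by (simp add: hform_def scalar_product_3 polar_def cmod_power2) (simp add: algebra_simps power2_eq_square)
  show ?thesis unfolding eq by (auto intro!: derivative_eq_intros)
qed

lemma polar_smult: "polar (c *s v) = cnj c *s polar v"
  by (simp add: polar_def vec_eq_iff forall_3)

lemma kernel_subset_imp_proportional: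
  fixes f g :: "complex^3"
  assumes "f \<noteq> 0" "\<And>w. scalar_product f w = 0 \<Longrightarrow> scalar_product g w = 0"
  obtains c where "g = c *s f"
proof -
  obtain i where i: "f $ i \<noteq> 0" using assms(1) by (auto simp: vec_eq_iff)
  have *: "f $ i * g $ j = f $ j * g $ i" for j
  proof (cases "j = i")
    case False
    define w :: "complex^3" where "w = (\<chi> m. if m = j then f $ i else if m = i then - f $ j else 0)"
    have sp: "scalar_product h w = f $ i * h $ j - f $ j * h $ i" for h :: "complex^3"
    proof -
      have "scalar_product h w = (\<Sum>m\<in>UNIV. (if m = j then f $ i * h $ j else 0) + (if m = i then - f $ j * h $ i else 0))"
        unfolding scalar_product_def w_def using False by (intro sum.cong) auto
      also have "\<dots> = f $ i * h $ j - f $ j * h $ i" by (simp add: sum.distrib)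
      finally show ?thesis .
    qed
    have "scalar_product f w = 0" by (simp add: sp)
    then show ?thesis using assms(2)[of w] by (simp add: sp)
  qed simp
  have "g = (g $ i / f $ i) *s f"
    using i * by (auto simp: vec_eq_iff field_simps)
  then show ?thesis by (rule that)
qed

lemma tangent_S3_abs_iff:
  assumes v: "v \<noteq> 0" and S: "abs_cp2 v \<in> S3"
  shows "tangent_S3 l (abs_cp2 v) \<longleftrightarrow> l = abs_cp2 (polar v)"
proof -
  obtain c where c: "c \<noteq> 0" "rep_cp2 (abs_cp2 v) = c *s v" by (rule rep_abs_cp2[OF v])
  obtain f where f: "f \<noteq> 0" "l = abs_cp2 f" by (rule abs_cp2_exhaust)
  obtain d where d: "d \<noteq> 0" "rep_cp2 l = d *s f" using rep_abs_cp2[OF f(1)] f(2) by metis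
  have sp: "scalar_product (a *s x) y = a * scalar_product x y"
      "scalar_product x (a *s y) = a * scalar_product x y" for a and x y :: "complex^3"
    by (simp_all add: scalar_product_3 algebra_simps)
  have T: "tangent_S3 l (abs_cp2 v) \<longleftrightarrow> scalar_product f v = 0 \<and>
     (\<forall>w. scalar_product f w = 0 \<longrightarrow> Re (cnj c * scalar_product (polar v) w) = 0)"
  proof -
    have inc: "incident (abs_cp2 v) l \<longleftrightarrow> scalar_product f v = 0"
      unfolding f(2) by (rule incident_abs_iff[OF v f(1)])
    have der: "((\<lambda>t. hform (c *s v + t *\<^sub>R w)) has_real_derivative 0) (at 0)
        \<longleftrightarrow> Re (cnj c * scalar_product (polar v) w) = 0" for w
    proof -
      have D: "((\<lambda>t. hform (c *s v + t *\<^sub>R w)) has_real_derivative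
          2 * Re (cnj c * scalar_product (polar v) w)) (at 0)"
        using hform_deriv[of "c *s v" w] by (simp only: polar_smult sp)
      show ?thesis
      proof
        assume "((\<lambda>t. hform (c *s v + t *\<^sub>R w)) has_real_derivative 0) (at 0)"
        from DERIV_unique[OF this D] show "Re (cnj c * scalar_product (polar v) w) = 0" by simp
      next
        assume "Re (cnj c * scalar_product (polar v) w) = 0"
        then have "2 * Re (cnj c * scalar_product (polar v) w) = 0" by (simp only: mult_zero_right)
        from D[unfolded this] show "((\<lambda>t. hform (c *s v + t *\<^sub>R w)) has_real_derivative 0) (at 0)" .
      qed
    qed
    show ?thesis
      unfolding tangent_S3_def inc d(2) c(2) sp der using d(1) by simp
  qed
  show ?thesis
  proof
    assume "tangent_S3 l (abs_cp2 v)"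
    then have *: "Re (cnj c * scalar_product (polar v) w) = 0" if "scalar_product f w = 0" for w
      using that T by blast
    have "scalar_product (polar v) w = 0" if "scalar_product f w = 0" for w
    proof -
      have "scalar_product f (\<i> *s w) = 0" using that by (simp add: sp)
      from *[OF this] *[OF that] have "cnj c * scalar_product (polar v) w = 0"
        by (simp add: sp complex_eq_iff)
      then show ?thesis using c(1) by simp
    qed
    then obtain e where e: "polar v = e *s f"
      using kernel_subset_imp_proportional[OF f(1)] by blast
    moreover have "e \<noteq> 0" using e polar_nonzero[OF v] by auto
    ultimately show "l = abs_cp2 (polar v)"
      using abs_cp2_eq_iff[OF f(1) polar_nonzero[OF v]] f(2) by blast
  next
    assume "l = abs_cp2 (polar v)"
    then obtain e where e: "e \<noteq> 0" "polar v = e *s f"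
      using abs_cp2_eq_iff[OF f(1) polar_nonzero[OF v]] f(2) by auto
    have "Im (scalar_product (polar v) v) = 0"
      by (simp add: scalar_product_3 polar_def)
    moreover have "Re (scalar_product (polar v) v) = 0"
      using S S3_abs_iff[OF v] by (simp add: hform_polar)
    ultimately have "scalar_product (polar v) v = 0" by (simp add: complex_eq_iff)
    then show "tangent_S3 l (abs_cp2 v)" unfolding T using e by (simp add: sp)
  qed
qed

lemma tangent_line_abs:
  assumes "v \<noteq> 0" "abs_cp2 v \<in> S3"
  shows "tangent_line (abs_cp2 v) = abs_cp2 (polar v)"
  unfolding tangent_line_def tangent_S3_abs_iff[OF assms] by simp

lemma is_flag_CR_flag: "p \<in> S3 \<Longrightarrow> is_flag (CR_flag p)"
proof -
  assume p: "p \<in> S3"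
  obtain v where v: "v \<noteq> 0" "p = abs_cp2 v" by (rule abs_cp2_exhaust)
  have "tangent_S3 (tangent_line p) p"
    using p unfolding v(2) by (simp add: tangent_S3_abs_iff[OF v(1)] tangent_line_abs[OF v(1)])
  then show ?thesis by (simp add: is_flag_def CR_flag_def tangent_S3_def)
qed


section \<open>Conjugation on the pre-Bloch group\<close>

lemma conj_frag_simps:
  "conj_frag 0 = 0" "conj_frag (frag_of x) = frag_of (cnj x)"
  "conj_frag (a + b) = conj_frag a + conj_frag b" "conj_frag (a - b) = conj_frag a - conj_frag b"
  "conj_frag (- a) = - conj_frag a"
  by (simp_all add: conj_frag_def frag_extend_add frag_extend_diff frag_extend_minus)

lemma conj_frag_five_term: "conj_frag (five_term x y) = five_term (cnj x) (cnj y)"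
  by (simp add: five_term_def conj_frag_simps)

lemma conj_frag_conj_frag: "conj_frag (conj_frag c) = c"
proof -
  have "Poly_Mapping.keys c \<subseteq> UNIV" by simp
  then show ?thesis
    by (induction c rule: frag_induction) (auto simp: conj_frag_simps)
qed

lemma conj_frag_subgroup:
  assumes "c \<in> five_term_subgroup"
  shows "conj_frag c \<in> five_term_subgroup"
proof -
  let ?H = "{five_term x y | x y. x \<in> UNIV - {0, 1} \<and> y \<in> UNIV - {0, 1} \<and> x \<noteq> y}"
  have keys: "Poly_Mapping.keys (five_term x y) \<subseteq> - {0, 1}"
    if xy: "x \<in> UNIV - {0, 1}" "y \<in> UNIV - {0, 1}" "x \<noteq> y" for x y
  proof -
    let ?S = "- {0, 1} :: complex set"
    have add: "Poly_Mapping.keys (a + b) \<subseteq> ?S" and diff: "Poly_Mapping.keys (a - b) \<subseteq> ?S"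
      if "Poly_Mapping.keys a \<subseteq> ?S" "Poly_Mapping.keys b \<subseteq> ?S" for a b :: "complex \<Rightarrow>\<^sub>0 int"
      using that Poly_Mapping.keys_add[of a b] keys_diff[of a b] by blast+
    have "1 - inverse x \<noteq> 0" "1 - inverse y \<noteq> 0" "1 - x \<noteq> 0" "1 - y \<noteq> 0"
      using xy by simp_all
    then have "y / x \<in> ?S" "(1 - inverse x) / (1 - inverse y) \<in> ?S" "(1 - x) / (1 - y) \<in> ?S"
      "x \<in> ?S" "y \<in> ?S"
      using xy by (simp_all add: divide_eq_1_iff)
    then show ?thesis
      unfolding five_term_def by (intro add diff) simp_all
  qed
  have conjH: "conj_frag h \<in> ?H" if h: "h \<in> ?H" for h
  proof -
    obtain x y where "h = five_term x y" "x \<in> UNIV - {0, 1}" "y \<in> UNIV - {0, 1}" "x \<noteq> y"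
      using h by blast
    then have "conj_frag h = five_term (cnj x) (cnj y)" "cnj x \<in> UNIV - {0, 1}" "cnj y \<in> UNIV - {0, 1}"
      "cnj x \<noteq> cnj y"
      by (auto simp: conj_frag_five_term)
    then show ?thesis by blast
  qed
  show ?thesis
    using assms unfolding five_term_subgroup_def
  proof (induction rule: generate.induct)
    case one
    show ?case using generate.one[of frag_group ?H] by (simp add: frag_group_def conj_frag_simps)
  next
    case (incl h)
    then show ?case by (intro generate.incl conjH)
  next
    case (inv h)
    have carr: "g \<in> carrier frag_group" if "g \<in> ?H" for g
    proof -
      obtain x y where "g = five_term x y" "x \<in> UNIV - {0, 1}" "y \<in> UNIV - {0, 1}" "x \<noteq> y"
        using \<open>g \<in> ?H\<close> by blast
      then show ?thesis using keys[of x y] by (auto simp: frag_group_def)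
    qed
    have "h \<in> carrier frag_group" "conj_frag h \<in> carrier frag_group"
      using carr[OF inv] carr[OF conjH[OF inv]] by blast+
    then show ?case
      using generate.inv[OF conjH[OF inv], of frag_group]
      by (simp add: frag_group_def conj_frag_simps)
  next
    case (eng h1 h2)
    then show ?case using generate.eng[OF eng.IH] by (simp add: frag_group_def conj_frag_simps)
  qed
qed

lemma tau_class: "tau (pre_Bloch_class c) = pre_Bloch_class (conj_frag c)"
proof -
  have coset: "pre_Bloch_class c = (\<lambda>r. r + c) ` five_term_subgroup" for c
    by (auto simp: pre_Bloch_class_def r_coset_def frag_group_def)
  have "conj_frag ` five_term_subgroup = five_term_subgroup"
  proof (intro subset_antisym image_subsetI subsetI)
    fix r assume "r \<in> five_term_subgroup"
    then show "conj_frag r \<in> five_term_subgroup" by (rule conj_frag_subgroup)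
    from conj_frag_subgroup[OF \<open>r \<in> five_term_subgroup\<close>]
    show "r \<in> conj_frag ` five_term_subgroup"
      by (metis conj_frag_conj_frag image_eqI)
  qed
  then have "(\<lambda>r. r + conj_frag c) ` five_term_subgroup = (\<lambda>r. r + conj_frag c) ` conj_frag ` five_term_subgroup"
    by simp
  then show ?thesis
    unfolding tau_def coset by (simp add: image_image conj_frag_simps(3))
qed

end

theory Submission
  imports Defs "HOL-Real_Asymp.Real_Asymp"
begin

unbundle no fps_syntax

text \<open>A tetrahedron of flags and its complex conjugate turn out to be described by one matrix and its
transpose.  Let \<open>x\<^sub>1, \<dots>, x\<^sub>4\<close> be null vectors over the vertices of a spherical CR tetrahedron, let
\<open>\<lambda>\<^sub>1 x\<^sub>1 + \<dots> + \<lambda>\<^sub>4 x\<^sub>4 = 0\<close> be their linear relation, and weight the Gram matrix of the Hermitian form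
by the \<open>\<lambda>\<^sub>i\<close>.  The result \<open>B\<close> is Hermitian, has zero diagonal and zero row and column sums, and
\<open>z\<^sub>i\<^sub>j = - B\<^sub>i\<^sub>k / B\<^sub>i\<^sub>l\<close>, \<open>z\<^sub>i\<^sub>j\<^sub>k = B\<^sub>i\<^sub>j B\<^sub>j\<^sub>k B\<^sub>k\<^sub>i / (B\<^sub>i\<^sub>k B\<^sub>j\<^sub>i B\<^sub>k\<^sub>j)\<close> (\<open>zero_line_sum_matrix_exists\<close>).
Conjugating all coordinates replaces \<open>B\<close> by its transpose.

For an arbitrary matrix with these vanishing sums, six five-term relations show that the invariant
\<open>[z\<^sub>1\<^sub>2] + [z\<^sub>2\<^sub>1] + [z\<^sub>3\<^sub>4] + [z\<^sub>4\<^sub>3]\<close> changes under transposition by an alternating sum of the four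
elements \<open>[- z\<^sub>i\<^sub>j\<^sub>k]\<close> (\<open>tetrahedron_identity\<close>).  With the boundary orientation of the faces this says
that \<open>\<beta>(K, z) - \<beta>(K, cnj z)\<close> is minus the sum of \<open>[- z\<^sub>i\<^sub>j\<^sub>k]\<close> over all faces of all simplices
(\<open>CR_tetrahedron_conj_difference\<close>).  The compatibility condition makes the face coordinates of two
glued faces inverse to each other, and \<open>[1/u] = - [u]\<close>, so the faces cancel in pairs
(\<open>sum_face_brackets\<close>).

For the volume, the Bloch-Wigner function satisfies the five-term relation
(\<open>Bloch_Wigner_five_term\<close>), hence is defined on the pre-Bloch group, and it is odd under complex
conjugation.  It therefore vanishes on every class that is its own conjugate.\<close>


section \<open>The pre-Bloch group as a type\<close>

lemma five_term_in_frag_group: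
  assumes "x \<in> UNIV - {0, 1}" "y \<in> UNIV - {0, 1}" "x \<noteq> y"
  shows "five_term x y \<in> carrier frag_group"
proof -
  have add: "a + b \<in> carrier frag_group" and diff: "a - b \<in> carrier frag_group"
    if "a \<in> carrier frag_group" "b \<in> carrier frag_group" for a b
    using that Poly_Mapping.keys_add[of a b] keys_diff[of a b] by (auto simp: frag_group_def)
  have of: "frag_of u \<in> carrier frag_group" if "u \<noteq> 0" "u \<noteq> 1" for u
    using that by (simp add: frag_group_def)
  have "inverse x \<noteq> 1" "inverse y \<noteq> 1" using assms by auto
  then show ?thesis
    unfolding five_term_def using assms
    by (intro add diff of) (auto simp: divide_eq_1_iff)
qed

lemma five_term_subgroup_0: "0 \<in> five_term_subgroup"
  unfolding five_term_subgroup_def using generate.one[of frag_group] by (simp add: frag_group_def)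

lemma five_term_subgroup_add:
  "a \<in> five_term_subgroup \<Longrightarrow> b \<in> five_term_subgroup \<Longrightarrow> a + b \<in> five_term_subgroup"
  unfolding five_term_subgroup_def using generate.eng[of a frag_group _ b] by (simp add: frag_group_def)

lemma five_term_in_subgroup:
  "x \<in> UNIV - {0, 1} \<Longrightarrow> y \<in> UNIV - {0, 1} \<Longrightarrow> x \<noteq> y \<Longrightarrow> five_term x y \<in> five_term_subgroup"
  unfolding five_term_subgroup_def by (rule generate.incl) blast

lemma five_term_subgroup_induct [consumes 1, case_names zero five_term minus_five_term add]:
  assumes "c \<in> five_term_subgroup" "P 0"
    and "\<And>x y. x \<in> UNIV - {0, 1} \<Longrightarrow> y \<in> UNIV - {0, 1} \<Longrightarrow> x \<noteq> y \<Longrightarrow> P (five_term x y)"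
    and "\<And>x y. x \<in> UNIV - {0, 1} \<Longrightarrow> y \<in> UNIV - {0, 1} \<Longrightarrow> x \<noteq> y \<Longrightarrow> P (- five_term x y)"
    and "\<And>a b. a \<in> five_term_subgroup \<Longrightarrow> b \<in> five_term_subgroup \<Longrightarrow> P a \<Longrightarrow> P b \<Longrightarrow> P (a + b)"
  shows "P c"
  using assms(1) unfolding five_term_subgroup_def
proof (induction rule: generate.induct)
  case one
  then show ?case using assms(2) by (simp add: frag_group_def)
next
  case (incl h)
  then show ?case using assms(3) by blast
next
  case (inv h)
  then obtain x y where h: "h = five_term x y" "x \<in> UNIV - {0, 1}" "y \<in> UNIV - {0, 1}" "x \<noteq> y" by blast
  then have "inv\<^bsub>frag_group\<^esub> h = - five_term x y"
    using five_term_in_frag_group[OF h(2-4)] by (simp add: frag_group_def)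
  then show ?case using assms(4)[OF h(2-4)] by simp
next
  case (eng a b)
  then show ?case using assms(5)[unfolded five_term_subgroup_def, of a b] by (simp add: frag_group_def)
qed

lemma five_term_subgroup_uminus: "c \<in> five_term_subgroup \<Longrightarrow> - c \<in> five_term_subgroup"
proof (induction rule: five_term_subgroup_induct)
  case (minus_five_term x y)
  then show ?case by (simp add: five_term_in_subgroup)
next
  case (five_term x y)
  have "inv\<^bsub>frag_group\<^esub> (five_term x y) \<in> five_term_subgroup"
    unfolding five_term_subgroup_def using five_term by (intro generate.inv) blast
  then show ?case
    using five_term_in_frag_group[OF five_term] by (simp add: frag_group_def)
next
  case (add a b)
  then show ?case using five_term_subgroup_add[of "- a" "- b"] by simp
qed (simp add: five_term_subgroup_0)

lemma five_term_subgroup_diff: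
  "a \<in> five_term_subgroup \<Longrightarrow> b \<in> five_term_subgroup \<Longrightarrow> a - b \<in> five_term_subgroup"
  using five_term_subgroup_add[OF _ five_term_subgroup_uminus, of a b] by simp

text \<open>The pre-Bloch group is realised once more, as a quotient type, so that sums and differences in it are
those of the class of abelian groups.  Its elements correspond to the cosets of the five-term
subgroup by \<open>pre_Bloch_class_eq_iff\<close>.\<close>

definition five_term_rel :: "(complex \<Rightarrow>\<^sub>0 int) \<Rightarrow> (complex \<Rightarrow>\<^sub>0 int) \<Rightarrow> bool" where
  "five_term_rel a b \<longleftrightarrow> a - b \<in> five_term_subgroup"

quotient_type bloch = "complex \<Rightarrow>\<^sub>0 int" / five_term_rel
proof (rule equivpI)
  show "reflp five_term_rel" by (rule reflpI) (simp add: five_term_rel_def five_term_subgroup_0)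
  show "symp five_term_rel"
    by (rule sympI) (metis five_term_rel_def five_term_subgroup_uminus minus_diff_eq)
  show "transp five_term_rel"
  proof (rule transpI)
    fix a b c assume "five_term_rel a b" "five_term_rel b c"
    then have "(a - b) + (b - c) \<in> five_term_subgroup"
      unfolding five_term_rel_def by (rule five_term_subgroup_add)
    then show "five_term_rel a c" by (simp add: five_term_rel_def)
  qed
qed

instantiation bloch :: ab_group_add
begin
lift_definition zero_bloch :: bloch is 0 .
lift_definition plus_bloch :: "bloch \<Rightarrow> bloch \<Rightarrow> bloch" is "(+)"
  unfolding five_term_rel_def add_diff_add by (rule five_term_subgroup_add)
lift_definition uminus_bloch :: "bloch \<Rightarrow> bloch" is uminus
  unfolding five_term_rel_def using five_term_subgroup_uminus by (metis minus_diff_minus)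
lift_definition minus_bloch :: "bloch \<Rightarrow> bloch \<Rightarrow> bloch" is "(-)"
proof -
  fix a b c d :: "complex \<Rightarrow>\<^sub>0 int"
  assume "five_term_rel a b" "five_term_rel c d"
  then have "(a - b) - (c - d) \<in> five_term_subgroup"
    unfolding five_term_rel_def by (rule five_term_subgroup_diff)
  also have "(a - b) - (c - d) = a - c - (b - d)" by simp
  finally show "five_term_rel (a - c) (b - d)" by (simp only: five_term_rel_def)
qed
instance
proof
  have rel: "five_term_rel u v" if "u = v" for u v
    using that by (simp add: five_term_rel_def five_term_subgroup_0)
  fix a b c :: bloch
  show "a + b + c = a + (b + c)" by transfer (rule rel, rule add.assoc)
  show "a + b = b + a" by transfer (rule rel, rule add.commute)
  show "0 + a = a" by transfer (rule rel, simp)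
  show "- a + a = 0" by transfer (rule rel, simp)
  show "a - b = a + - b" by transfer (rule rel, simp)
qed
end

lemma abs_bloch_simps:
  "abs_bloch 0 = 0" "abs_bloch (a + b) = abs_bloch a + abs_bloch b"
  "abs_bloch (a - b) = abs_bloch a - abs_bloch b" "abs_bloch (- a) = - abs_bloch a"
  by (simp_all add: zero_bloch_def plus_bloch.abs_eq minus_bloch.abs_eq uminus_bloch.abs_eq)

lemma abs_bloch_sum: "abs_bloch (sum f A) = (\<Sum>a\<in>A. abs_bloch (f a))"
  by (induction A rule: infinite_finite_induct) (simp_all add: abs_bloch_simps)

lemma pre_Bloch_class_eq_iff: "pre_Bloch_class a = pre_Bloch_class b \<longleftrightarrow> abs_bloch a = abs_bloch b"
proof -
  have cls: "u \<in> pre_Bloch_class c \<longleftrightarrow> u - c \<in> five_term_subgroup" for u c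
    by (auto simp: pre_Bloch_class_def r_coset_def frag_group_def intro: bexI[of _ "u - c"])
  have "abs_bloch a = abs_bloch b \<longleftrightarrow> a - b \<in> five_term_subgroup"
    by (simp add: bloch.abs_eq_iff five_term_rel_def)
  also have "\<dots> \<longleftrightarrow> pre_Bloch_class a = pre_Bloch_class b"
  proof
    assume ab: "a - b \<in> five_term_subgroup"
    have "u - a \<in> five_term_subgroup \<longleftrightarrow> u - b \<in> five_term_subgroup" for u
      using five_term_subgroup_add[OF _ ab, of "u - a"] five_term_subgroup_diff[OF _ ab, of "u - b"] by auto
    then show "pre_Bloch_class a = pre_Bloch_class b" using cls by blast
  next
    assume "pre_Bloch_class a = pre_Bloch_class b"
    moreover have "a \<in> pre_Bloch_class a" by (simp add: cls five_term_subgroup_0)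
    ultimately show "a - b \<in> five_term_subgroup" by (simp add: cls)
  qed
  finally show ?thesis ..
qed

text \<open>The generator \<open>[x]\<close>, extended by \<open>[1] = 0\<close>.  With this value the five-term relation also holds for
\<open>x = y\<close>, where it reads \<open>[x] - [x] + [1] - [1] + [1] = 0\<close>.  This spares every case distinction for
tetrahedra in which an argument of one of the relations degenerates.\<close>

definition bracket :: "complex \<Rightarrow> bloch" where
  "bracket x = (if x = 1 then 0 else abs_bloch (frag_of x))"

lemma bracket_five_term:
  assumes "x \<notin> {0, 1}" "y \<notin> {0, 1}"
  shows "bracket x - bracket y + bracket (y / x) - bracket ((1 - 1 / x) / (1 - 1 / y))
    + bracket ((1 - x) / (1 - y)) = 0"
proof (cases "x = y")
  case True
  then show ?thesis using assms by (simp add: bracket_def)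
next
  case False
  then have "abs_bloch (five_term x y) = 0"
    using assms five_term_in_subgroup[of x y]
    by (simp add: zero_bloch_def bloch.abs_eq_iff five_term_rel_def)
  moreover have "y / x \<noteq> 1" "(1 - inverse x) / (1 - inverse y) \<noteq> 1" "(1 - x) / (1 - y) \<noteq> 1"
    using assms False by (auto simp: divide_eq_1_iff)
  ultimately show ?thesis
    using assms by (simp add: five_term_def abs_bloch_simps bracket_def inverse_eq_divide)
qed

text \<open>Adding the five-term relations of \<open>(x, y)\<close> and \<open>(y, x)\<close> shows that \<open>i(u) = [u] + [1/u]\<close> is
multiplicative.  As \<open>i(1/u) = i(u)\<close>, it vanishes on squares, and every complex number is a square.\<close>

lemma bracket_inverse:
  assumes "z \<noteq> 0"
  shows "bracket (1 / z) = - bracket z"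
proof -
  define i where "i = (\<lambda>u. bracket u + bracket (1 / u))"
  have mult: "i (u * v) = i u + i v" if uv: "u \<notin> {0, 1}" "v \<notin> {0, 1}" "u * v \<noteq> 1" for u v
  proof -
    \<comment> \<open>the solution of \<open>y / x = u\<close> and \<open>(1 - x) / (1 - y) = v\<close>\<close>
    let ?x = "(v - 1) / (u * v - 1)"
    let ?y = "u * ?x"
    have nz: "u \<noteq> 0" "v \<noteq> 0" "u - 1 \<noteq> 0" "v - 1 \<noteq> 0" "u * v - 1 \<noteq> 0" using uv by auto
    have x: "?x \<notin> {0, 1}" using nz by (auto simp: divide_eq_1_iff)
    have y: "?y \<notin> {0, 1}"
    proof -
      have "u * (v - 1) \<noteq> u * v - 1" using nz by (simp add: algebra_simps)
      then show ?thesis using nz by (simp add: divide_eq_1_iff)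
    qed
    have x1: "1 - ?x = v * (u - 1) / (u * v - 1)" and y1: "1 - ?y = (u - 1) / (u * v - 1)"
      using nz by (simp_all add: field_simps)
    have "?y / ?x = u" "(1 - ?x) / (1 - ?y) = v" "(1 - ?y) / (1 - ?x) = 1 / v" "?x / ?y = 1 / u"
      unfolding x1 y1 using nz by (simp_all)
    moreover have "1 - 1 / ?x = - (v * (u - 1) / (v - 1))" "1 - 1 / ?y = - ((u - 1) / (u * (v - 1)))"
      using nz by (simp_all add: field_simps)
    then have "(1 - 1 / ?x) / (1 - 1 / ?y) = u * v" "(1 - 1 / ?y) / (1 - 1 / ?x) = 1 / (u * v)"
      using nz by (simp_all)
    ultimately have "bracket ?x - bracket ?y + bracket u - bracket (u * v) + bracket v = 0"
      "bracket ?y - bracket ?x + bracket (1 / u) - bracket (1 / (u * v)) + bracket (1 / v) = 0"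
      using bracket_five_term[OF x y] bracket_five_term[OF y x] by (simp_all only:)
    moreover have "i u + i v - i (u * v) =
        (bracket ?x - bracket ?y + bracket u - bracket (u * v) + bracket v)
        + (bracket ?y - bracket ?x + bracket (1 / u) - bracket (1 / (u * v)) + bracket (1 / v))"
      unfolding i_def by (simp add: algebra_simps)
    ultimately show ?thesis by simp
  qed
  show ?thesis
  proof (cases "z = 1")
    case False
    define u where "u = csqrt z"
    have u2: "u * u = z" unfolding u_def by (metis power2_csqrt power2_eq_square)
    have u: "u \<notin> {0, 1}" "1 / u \<notin> {0, 1}" using u2 False assms by auto
    have "i (1 / u) = i u" by (simp add: i_def add.commute)
    moreover have "i ((u * u) * (1 / u)) = i (u * u) + i (1 / u)"
      using u u2 False assms by (intro mult) auto
    ultimately have "i (u * u) = 0" using u by simp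
    then show ?thesis using u2 by (simp add: i_def eq_neg_iff_add_eq_0 add.commute)
  qed (simp add: bracket_def)
qed

text \<open>The relations of \<open>(x, y)\<close> and of \<open>(1 - y, 1 - x)\<close> have three terms in common, and their difference
says that \<open>[x] + [1 - x]\<close> does not depend on \<open>x\<close>.  At a primitive sixth root of unity \<open>w\<close> one has
\<open>1 - w = 1/w\<close>, so the constant is zero.\<close>

lemma bracket_1_minus:
  assumes "z \<notin> {0, 1}"
  shows "bracket (1 - z) = - bracket z"
proof -
  have const: "bracket x + bracket (1 - x) = bracket y + bracket (1 - y)"
    if x: "x \<notin> {0, 1}" and y: "y \<notin> {0, 1}" for x y
  proof -
    have "1 - y \<notin> {0, 1}" "1 - x \<notin> {0, 1}" using x y by auto
    note bracket_five_term[OF this]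
    moreover have "(1 - 1 / (1 - y)) / (1 - 1 / (1 - x)) = (1 - 1 / x) / (1 - 1 / y)"
    proof -
      have nz: "x \<noteq> 0" "y \<noteq> 0" "1 - x \<noteq> 0" "1 - y \<noteq> 0" using x y by auto
      have "1 - 1 / (1 - y) = - y / (1 - y)" "1 - 1 / (1 - x) = - x / (1 - x)"
        "1 - 1 / x = - (1 - x) / x" "1 - 1 / y = - (1 - y) / y" using nz by (simp_all add: field_simps)
      then show ?thesis using nz by (simp only:) (simp add: divide_simps, simp add: algebra_simps)
    qed
    ultimately have "bracket (1 - y) - bracket (1 - x) + bracket ((1 - x) / (1 - y))
        - bracket ((1 - 1 / x) / (1 - 1 / y)) + bracket (y / x) = 0"
      by simp
    moreover note bracket_five_term[OF x y]
    moreover have "(bracket x + bracket (1 - x)) - (bracket y + bracket (1 - y)) =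
        (bracket x - bracket y + bracket (y / x) - bracket ((1 - 1 / x) / (1 - 1 / y)) + bracket ((1 - x) / (1 - y)))
        - (bracket (1 - y) - bracket (1 - x) + bracket ((1 - x) / (1 - y))
        - bracket ((1 - 1 / x) / (1 - 1 / y)) + bracket (y / x))"
      by (simp add: algebra_simps)
    ultimately show ?thesis by simp
  qed
  define w :: complex where "w = Complex (1 / 2) (sqrt 3 / 2)"
  have w: "w \<notin> {0, 1}" "1 - w = 1 / w"
  proof -
    show "w \<notin> {0, 1}" by (auto simp: w_def complex_eq_iff)
    have "(1 - w) * w = 1"
      by (simp add: w_def complex_eq_iff field_simps)
    then show "1 - w = 1 / w" using \<open>w \<notin> {0, 1}\<close> by (simp add: field_simps)
  qed
  have "bracket w + bracket (1 - w) = 0"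
    using w bracket_inverse[of w] by simp
  then have "bracket z + bracket (1 - z) = 0" using const[OF assms w(1)] by simp
  then show ?thesis by (simp add: eq_neg_iff_add_eq_0 add.commute)
qed


section \<open>The five-term chain of a tetrahedron\<close>

text \<open>The relation with \<open>1 - x\<close>, \<open>1 - 1/x\<close>, \<open>1 - y\<close>, \<open>1 - 1/y\<close> given in factored form, so that the arguments
of the last three terms simplify to monomials.\<close>

lemma bracket_five_term_eq:
  assumes "x \<noteq> 0" "y \<noteq> 0" and "1 - x = x1" "1 - y = y1" "1 - 1 / x = x2" "1 - 1 / y = y2"
    and "x1 \<noteq> 0" "y1 \<noteq> 0" and "y / x = u" "x2 / y2 = v" "x1 / y1 = w"
  shows "bracket x - bracket y + bracket u - bracket v + bracket w = 0"
proof -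
  have "x \<noteq> 1" "y \<noteq> 1" using assms by auto
  then show ?thesis
    using bracket_five_term[of x y] assms by simp
qed

lemma one_minus_neg_ratio:
  fixes a b c :: complex
  assumes "a + b + c = 0" "a \<noteq> 0" "b \<noteq> 0"
  shows "1 - - a / b = - c / b" "1 - 1 / (- a / b) = - c / a"
proof -
  have c: "c = - a - b" using assms(1) by (simp add: eq_diff_eq add_eq_0_iff algebra_simps)
  show "1 - - a / b = - c / b" "1 - 1 / (- a / b) = - c / a"
    unfolding c using assms(2,3) by (simp_all add: field_simps)
qed

lemma neg_ratio_not_0_1:
  fixes a b c :: complex
  assumes "a + b + c = 0" "a \<noteq> 0" "b \<noteq> 0" "c \<noteq> 0"
  shows "- a / b \<notin> {0, 1}"
proof -
  have "- a / b \<noteq> 1"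
  proof
    assume "- a / b = 1"
    then have "- c / b = 0" using one_minus_neg_ratio(1)[OF assms(1-3)] by simp
    then show False using assms by simp
  qed
  then show ?thesis using assms by simp
qed

lemma bracket_neg_ratio_flip:
  assumes "a \<noteq> 0" "b \<noteq> 0"
  shows "bracket (- a / b) = - bracket (- b / a)"
  using bracket_inverse[of "- b / a"] assms by simp

lemma bracket_neg_ratio_rotate:
  fixes a b c :: complex
  assumes "a + b + c = 0" "a \<noteq> 0" "b \<noteq> 0" "c \<noteq> 0"
  shows "bracket (- b / c) = bracket (- a / b)"
proof -
  have "bracket (- b / c) = - bracket (- c / b)" by (rule bracket_neg_ratio_flip[OF assms(3,4)])
  also have "\<dots> = - bracket (1 - - a / b)" by (simp only: one_minus_neg_ratio(1)[OF assms(1-3)])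
  also have "\<dots> = bracket (- a / b)" by (simp only: bracket_1_minus[OF neg_ratio_not_0_1[OF assms]] minus_minus)
  finally show ?thesis .
qed

text \<open>In a matrix with zero diagonal and zero line sums all principal minors of size three agree.  Here
one index of the three is replaced by the fourth index of the matrix, whose entries are minus the
sums of the others.\<close>

lemma minor_eq:
  fixes a b c d e f :: complex
  assumes "a + b + c + d + e + f = 0"
  shows "a * (- c - d) * (- c - e) + (- a - b) * (- a - f) * c = a * d * e + b * f * c"
proof -
  have "a * (- c - d) * (- c - e) + (- a - b) * (- a - f) * c = a * d * e + b * f * c + a * c * (a + b + c + d + e + f)"
    by (simp add: algebra_simps)
  then show ?thesis using assms by simp
qed

text \<open>The difference of the two sides is a signed sum of six five-term relations.  In them \<open>k\<close> is the common
value of the principal minors of size three, and all arguments are, up to sign, monomials in the entries of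
the matrix and \<open>k\<close>.  Besides the twelve brackets of the statement nine others occur, each in exactly
two of the relations, and these cancel.\<close>

lemma tetrahedron_identity:
  fixes b12 b13 b14 b21 b23 b24 b31 b32 b34 b41 b42 b43 k :: complex
  assumes rows: "b12 + b13 + b14 = 0" "b21 + b23 + b24 = 0" "b31 + b32 + b34 = 0" "b41 + b42 + b43 = 0"
    and cols: "b21 + b31 + b41 = 0" "b12 + b32 + b42 = 0" "b13 + b23 + b43 = 0" "b14 + b24 + b34 = 0"
    and nz: "b12 \<noteq> 0" "b13 \<noteq> 0" "b14 \<noteq> 0" "b21 \<noteq> 0" "b23 \<noteq> 0" "b24 \<noteq> 0"
      "b31 \<noteq> 0" "b32 \<noteq> 0" "b34 \<noteq> 0" "b41 \<noteq> 0" "b42 \<noteq> 0" "b43 \<noteq> 0"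
    and k: "k = b12 * b23 * b31 + b13 * b32 * b21" "k \<noteq> 0"
  shows "(bracket (- b12 / b13) - bracket (- b21 / b23) + bracket (- b31 / b32) - bracket (- b41 / b42))
      - (bracket (- b21 / b31) - bracket (- b12 / b32) + bracket (- b13 / b23) - bracket (- b14 / b24))
    = bracket (- (b12 * b23 * b31) / (b13 * b32 * b21)) - bracket (- (b12 * b24 * b41) / (b14 * b42 * b21))
      + bracket (- (b13 * b34 * b41) / (b14 * b43 * b31)) - bracket (- (b23 * b34 * b42) / (b24 * b43 * b32))"
proof -
  have six: "b12 + b13 + b21 + b23 + b31 + b32 = 0"
  proof -
    have "b12 + b13 + b21 + b23 + b31 + b32 =
        (b12 + b13 + b14) + (b21 + b23 + b24) + (b31 + b32 + b34) - (b14 + b24 + b34)" by simp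
    then show ?thesis by (simp only: rows cols add_0 diff_zero)
  qed
  have six': "b13 + b12 + b31 + b32 + b21 + b23 = 0" "b23 + b21 + b32 + b31 + b12 + b13 = 0"
    using six by (simp_all only: ac_simps)
  have b4: "b14 = - b12 - b13" "b24 = - b21 - b23" "b34 = - b31 - b32"
    "b41 = - b21 - b31" "b42 = - b12 - b32" "b43 = - b13 - b23"
    using rows cols by (simp_all add: eq_diff_eq add_eq_0_iff algebra_simps)
  have k124: "k = b12 * b24 * b41 + b14 * b42 * b21"
    unfolding b4 k(1) using minor_eq[of b12 b13 b21 b23 b31 b32] six by simp
  have k134: "k = b13 * b34 * b41 + b14 * b43 * b31"
    unfolding b4 k(1) using minor_eq[of b13 b12 b31 b32 b21 b23, OF six'(1)] by (simp add: algebra_simps)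
  have k234: "k = b23 * b34 * b42 + b24 * b43 * b32"
    unfolding b4 k(1) using minor_eq[of b23 b21 b32 b31 b12 b13, OF six'(2)] by (simp add: algebra_simps)
  note neg = one_minus_neg_ratio
  have fac: "1 - - a / b = k / b" "1 - 1 / (- a / b) = k / a" "1 - k / b = - a / b" "1 - 1 / (k / b) = a / k"
    if "k = a + b" "a \<noteq> 0" "b \<noteq> 0" for a b :: complex
    using that k(2) by (simp_all add: field_simps)
  \<comment> \<open>the nine auxiliary brackets, shared by two relations each\<close>
  define A where "A = bracket (b21 * b13 / (b23 * b12))"
  define M where "M = bracket (b14 * b21 / (b12 * b24))"
  define N where "N = bracket (b14 * b23 / (b13 * b24))"
  define C1 where "C1 = bracket (- (b34 * b12 * b23) / k)"
  define C2 where "C2 = bracket (- (b34 * b13 * b21) / k)"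
  define C3 where "C3 = bracket (- (b43 * b12 * b24) / k)"
  define C4 where "C4 = bracket (- (b43 * b14 * b21) / k)"
  define G where "G = bracket (b43 * b14 / (b13 * b34))"
  define H where "H = bracket (b43 * b24 / (b23 * b34))"
  let ?P = "bracket (- b12 / b13)" and ?Q = "bracket (- b21 / b23)" and ?R = "bracket (- b31 / b32)"
    and ?S = "bracket (- b41 / b42)"
    and ?P' = "bracket (- b21 / b31)" and ?Q' = "bracket (- b12 / b32)" and ?R' = "bracket (- b13 / b23)"
    and ?S' = "bracket (- b14 / b24)"
    and ?F123 = "bracket (- (b12 * b23 * b31) / (b13 * b32 * b21))"
    and ?F124 = "bracket (- (b12 * b24 * b41) / (b14 * b42 * b21))"
    and ?F134 = "bracket (- (b13 * b34 * b41) / (b14 * b43 * b31))"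
    and ?F234 = "bracket (- (b23 * b34 * b42) / (b24 * b43 * b32))"
  have 1: "?P - ?Q + A - M + N = 0"
    unfolding A_def M_def N_def
    by (rule bracket_five_term_eq[OF _ _ neg(1)[of b12 b13 b14] neg(1)[of b21 b23 b24]
          neg(2)[of b12 b13 b14] neg(2)[of b21 b23 b24]])
      (use nz rows cols in \<open>auto simp: algebra_simps\<close>)
  have 2: "?R - ?F123 + bracket (1 / (b21 * b13 / (b23 * b12))) - C1 + C2 = 0"
    unfolding C1_def C2_def
    by (rule bracket_five_term_eq[OF _ _ neg(1)[of b31 b32 b34] fac(1)[of "b12 * b23 * b31" "b13 * b32 * b21"]
          neg(2)[of b31 b32 b34] fac(2)[of "b12 * b23 * b31" "b13 * b32 * b21"]])
      (use nz k rows cols in \<open>auto simp: algebra_simps\<close>)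
  have 3: "?S - ?F124 + bracket (1 / (b14 * b21 / (b12 * b24))) - C3 + C4 = 0"
    unfolding C3_def C4_def
    by (rule bracket_five_term_eq[OF _ _ neg(1)[of b41 b42 b43] fac(1)[of "b12 * b24 * b41" "b14 * b42 * b21"]
          neg(2)[of b41 b42 b43] fac(2)[of "b12 * b24 * b41" "b14 * b42 * b21"]])
      (use nz k(2) k124 rows cols in \<open>auto simp: algebra_simps\<close>)
  have 4: "?P' - bracket (k / (b14 * b43 * b31)) + bracket (1 / (- (b43 * b14 * b21) / k))
      - bracket (1 / (- (b34 * b13 * b21) / k)) + G = 0"
    unfolding G_def
    by (rule bracket_five_term_eq[OF _ _ neg(1)[OF cols(1)] fac(3)[OF k134]
          neg(2)[OF cols(1)] fac(4)[OF k134]])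
      (use nz k(2) in \<open>auto simp: algebra_simps\<close>)
  have 5: "?Q' - bracket (k / (b24 * b43 * b32)) + bracket (1 / (- (b43 * b12 * b24) / k))
      - bracket (1 / (- (b34 * b12 * b23) / k)) + H = 0"
    unfolding H_def
    by (rule bracket_five_term_eq[OF _ _ neg(1)[OF cols(2)] fac(3)[OF k234]
          neg(2)[OF cols(2)] fac(4)[OF k234]])
      (use nz k(2) in \<open>auto simp: algebra_simps\<close>)
  have 6: "?R' - ?S' + N - G + H = 0"
    unfolding N_def G_def H_def
    by (rule bracket_five_term_eq[OF _ _ neg(1)[of b13 b23 b43] neg(1)[of b14 b24 b34]
          neg(2)[of b13 b23 b43] neg(2)[of b14 b24 b34]])
      (use nz rows cols in \<open>auto simp: algebra_simps\<close>)
  have refl: "bracket (k / b) = - bracket (- a / b)" if "k = a + b" "a \<noteq> 0" "b \<noteq> 0" for a b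
  proof -
    have "- a / b \<notin> {0, 1}" using that k(2) by (auto simp: field_simps add_eq_0_iff)
    then show ?thesis using bracket_1_minus fac(1)[OF that] by metis
  qed
  have inv: "bracket (1 / (b21 * b13 / (b23 * b12))) = - A" "bracket (1 / (b14 * b21 / (b12 * b24))) = - M"
    "bracket (1 / (- (b34 * b12 * b23) / k)) = - C1" "bracket (1 / (- (b34 * b13 * b21) / k)) = - C2"
    "bracket (1 / (- (b43 * b12 * b24) / k)) = - C3" "bracket (1 / (- (b43 * b14 * b21) / k)) = - C4"
    unfolding A_def M_def C1_def C2_def C3_def C4_def
    by (rule bracket_inverse; use nz k(2) in simp)+
  have r4: "bracket (k / (b14 * b43 * b31)) = - ?F134" and r5: "bracket (k / (b24 * b43 * b32)) = - ?F234"
    using refl[OF k134] refl[OF k234] nz by simp_all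
  have "(?P - ?Q + ?R - ?S) - (?P' - ?Q' + ?R' - ?S') - (?F123 - ?F124 + ?F134 - ?F234) =
      (?P - ?Q + A - M + N) + (?R - ?F123 + - A - C1 + C2) - (?S - ?F124 + - M - C3 + C4)
      - (?P' - - ?F134 + - C4 - - C2 + G) + (?Q' - - ?F234 + - C3 - - C1 + H) - (?R' - ?S' + N - G + H)"
    by (simp add: algebra_simps)
  also have "\<dots> = 0"
    using 1 2 3 4 5 6 unfolding inv r4 r5 by (simp only:) simp
  finally show ?thesis by simp
qed


section \<open>Null vectors of the Hermitian form\<close>

abbreviation herm :: "complex^3 \<Rightarrow> complex^3 \<Rightarrow> complex" where
  "herm v w \<equiv> scalar_product (polar v) w"

abbreviation det3 :: "complex^3 \<Rightarrow> complex^3 \<Rightarrow> complex^3 \<Rightarrow> complex" where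
  "det3 u v w \<equiv> det (vector [u, v, w] :: complex^3^3)"

lemma herm_expand: "herm v w = cnj (v $ 3) * w $ 1 + cnj (v $ 2) * w $ 2 + cnj (v $ 1) * w $ 3"
  by (simp add: scalar_product_3 polar_def)

lemma cnj_herm: "cnj (herm v w) = herm w v"
  by (simp add: herm_expand algebra_simps)

lemma herm_self_eq_0: "hform v = 0 \<Longrightarrow> herm v v = 0"
  by (simp add: complex_eq_iff hform_polar) (simp add: herm_expand algebra_simps)

text \<open>The form has signature \<open>(2, 1)\<close>, so isotropic subspaces are lines.  Explicitly, after scaling the
third coordinates to one, orthogonality of two null vectors forces the squared distance of their
second coordinates to vanish.\<close>

lemma herm_null_vectors_nonzero:
  assumes v: "v \<noteq> 0" "hform v = 0" and w: "w \<noteq> 0" "hform w = 0"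
    and indep: "\<And>c. w \<noteq> c *s v"
  shows "herm v w \<noteq> 0"
proof
  assume 0: "herm v w = 0"
  have n: "x $ 1 * cnj (x $ 3) + x $ 2 * cnj (x $ 2) + cnj (x $ 1) * x $ 3 = 0" if "hform x = 0" for x :: "complex^3"
    using herm_self_eq_0[OF that] by (simp add: herm_expand algebra_simps)
  have last0: "x $ 2 = 0" if "hform x = 0" "x $ 3 = 0" for x :: "complex^3"
    using n[OF that(1)] that(2) by simp
  show False
  proof (cases "v $ 3 = 0 \<or> w $ 3 = 0")
    case True
    have *: "x $ 2 = 0 \<and> x $ 3 = 0 \<and> y $ 2 = 0 \<and> y $ 3 = 0"
      if "x $ 3 = 0" "hform x = 0" "hform y = 0" "herm x y = 0" "x \<noteq> 0" for x y :: "complex^3"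
    proof -
      have x2: "x $ 2 = 0" using last0 that by blast
      then have "x $ 1 \<noteq> 0" using that by (auto simp: vec_eq_iff forall_3)
      then have "y $ 3 = 0" using that(1,4) x2 by (simp add: herm_expand)
      then show ?thesis using x2 that last0 by blast
    qed
    have "herm w v = 0" using cnj_herm[of v w] 0 by simp
    then have z: "v $ 2 = 0 \<and> v $ 3 = 0 \<and> w $ 2 = 0 \<and> w $ 3 = 0"
      using True *[of v w] *[of w v] 0 v w by blast
    moreover have "v $ 1 \<noteq> 0" using z v by (auto simp: vec_eq_iff forall_3)
    ultimately have "w = (w $ 1 / v $ 1) *s v"
      by (simp add: vec_eq_iff forall_3)
    then show False using indep by blast
  next
    case False
    \<comment> \<open>affine coordinates, in which \<open>v\<close> and \<open>w\<close> have third coordinate one\<close>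
    define v1 v2 w1 w2 where d: "v1 = v $ 1 / v $ 3" "v2 = v $ 2 / v $ 3" "w1 = w $ 1 / w $ 3" "w2 = w $ 2 / w $ 3"
    have e: "v $ 1 = v1 * v $ 3" "v $ 2 = v2 * v $ 3" "w $ 1 = w1 * w $ 3" "w $ 2 = w2 * w $ 3"
      using False by (simp_all add: d)
    have "(v1 + v2 * cnj v2 + cnj v1) * (v $ 3 * cnj (v $ 3)) = 0"
      using n[OF v(2)] unfolding e by (simp add: algebra_simps)
    then have nv: "v1 + v2 * cnj v2 + cnj v1 = 0" using False by simp
    have "(w1 + w2 * cnj w2 + cnj w1) * (w $ 3 * cnj (w $ 3)) = 0"
      using n[OF w(2)] unfolding e by (simp add: algebra_simps)
    then have nw: "w1 + w2 * cnj w2 + cnj w1 = 0" using False by simp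
    have "(w1 + cnj v2 * w2 + cnj v1) * (w $ 3 * cnj (v $ 3)) = 0"
      using 0 unfolding herm_expand e by (simp add: algebra_simps)
    then have vw: "w1 + cnj v2 * w2 + cnj v1 = 0" using False by simp
    have wv: "cnj w1 + v2 * cnj w2 + v1 = 0"
      using arg_cong[OF vw, of cnj] by simp
    have "(v2 - w2) * cnj (v2 - w2) = (v1 + v2 * cnj v2 + cnj v1) + (w1 + w2 * cnj w2 + cnj w1)
        - (w1 + cnj v2 * w2 + cnj v1) - (cnj w1 + v2 * cnj w2 + v1)"
      by (simp add: algebra_simps)
    then have "v2 = w2" by (simp only: nv nw vw wv) simp
    then have "v1 - w1 = (v1 + v2 * cnj v2 + cnj v1) - (w1 + cnj v2 * w2 + cnj v1)"
      by (simp add: mult.commute)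
    then have "v1 = w1" by (simp only: nv vw) simp
    have "w = (w $ 3 / v $ 3) *s v"
      using False \<open>v1 = w1\<close> \<open>v2 = w2\<close> by (simp add: vec_eq_iff forall_3 e)
    then show False using indep by blast
  qed
qed

text \<open>The left-hand side is the Gram determinant of three null vectors.\<close>

lemma det3_polar_gram:
  assumes "herm u u = 0" "herm v v = 0" "herm w w = 0"
  shows "herm u v * herm v w * herm w u + herm u w * herm v u * herm w v = - (det3 u v w * cnj (det3 u v w))"
proof -
  let ?P = "vector [polar u, polar v, polar w] :: complex^3^3" and ?A = "vector [u, v, w] :: complex^3^3"
  have "det (?P ** transpose ?A) = det ?P * det ?A"
    by (simp add: det_mul)
  moreover have "det ?P = - cnj (det ?A)"
    by (simp add: det_3 polar_def)
  moreover have "det (?P ** transpose ?A) = herm u v * herm v w * herm w u + herm u w * herm v u * herm w v"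
    using assms by (simp add: det_3 matrix_matrix_mult_def transpose_def sum_3 scalar_product_3)
  ultimately show ?thesis by (simp add: mult.commute)
qed

text \<open>Three linearly dependent vectors lie on a projective line.  It carries two distinct points
\<open>u\<close>, \<open>v\<close> of the sphere, hence also the point \<open>u - cnj \<langle>u, v\<rangle> v\<close>, on which the form is negative: the line
meets the complex hyperbolic plane and cuts out a C-circle.\<close>

lemma C_circle_through_dependent:
  assumes p: "p \<in> S3" "q \<in> S3" "r \<in> S3" "p \<noteq> q"
    and det: "det3 (rep_cp2 p) (rep_cp2 q) (rep_cp2 r) = 0"
  shows "\<exists>C. is_C_circle C \<and> {p, q, r} \<subseteq> C"
proof -
  let ?u = "rep_cp2 p" and ?v = "rep_cp2 q" and ?w = "rep_cp2 r"
  have sp: "scalar_product f (x + c *s y) = scalar_product f x + c * scalar_product f y" for f x y :: "complex^3" and c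
    by (simp add: scalar_product_3 algebra_simps)
  have nz: "?u \<noteq> 0" "?v \<noteq> 0" "?w \<noteq> 0" by (simp_all add: rep_cp2_nonzero)
  have null: "hform ?u = 0" "hform ?v = 0" "hform ?w = 0" using p by (simp_all add: S3_def)
  have "\<not> invertible (vector [?u, ?v, ?w] :: complex^3^3)"
    using det by (simp add: invertible_det_nz)
  then obtain l where l: "l \<noteq> 0" "(vector [?u, ?v, ?w] :: complex^3^3) *v l = 0"
    by (metis invertible_left_inverse matrix_left_invertible_ker)
  have "scalar_product l ?u = 0 \<and> scalar_product l ?v = 0 \<and> scalar_product l ?w = 0"
    using l(2) by (simp add: vec_eq_iff forall_3 matrix_vector_mult_def sum_3 scalar_product_3 mult.commute)
  then have inc: "scalar_product l ?u = 0" "scalar_product l ?v = 0" "scalar_product l ?w = 0" by blast+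
  define c where "c = herm ?u ?v"
  have "c \<noteq> 0"
    unfolding c_def
  proof (rule herm_null_vectors_nonzero[OF nz(1) null(1) nz(2) null(2)])
    fix a show "?v \<noteq> a *s ?u"
    proof
      assume *: "?v = a *s ?u"
      then have "a \<noteq> 0" using nz by auto
      then have "abs_cp2 ?u = abs_cp2 ?v" using abs_cp2_eq_iff[OF nz(1,2)] * by blast
      then show False using p(4) by (simp add: abs_rep_cp2)
    qed
  qed
  \<comment> \<open>the coefficient makes \<open>\<langle>y, y\<rangle> = - 2 |c|\<^sup>2\<close> negative\<close>
  define y where "y = ?u + (- cnj c) *s ?v"
  have "herm y y = herm ?u ?u + (- cnj c) * c + (- c) * (cnj c) + c * cnj c * herm ?v ?v"
    unfolding y_def c_def cnj_herm by (simp add: herm_expand algebra_simps)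
  then have "herm y y = - 2 * (c * cnj c)" using herm_self_eq_0 null by simp
  then have neg: "hform y < 0"
    using \<open>c \<noteq> 0\<close> by (simp add: hform_polar complex_mult_cnj complex_neq_0)
  then have y: "y \<noteq> 0" by (auto simp: hform_def)
  have "scalar_product l y = 0" unfolding y_def sp using inc by simp
  then have "abs_cp2 y \<in> {p \<in> H2C. incident p (abs_cp2 l)}"
    using neg y l(1) by (simp add: H2C_abs_iff incident_abs_iff)
  then have "is_C_circle {p \<in> S3. incident p (abs_cp2 l)}"
    unfolding is_C_circle_def by blast
  moreover have "incident p (abs_cp2 l)" "incident q (abs_cp2 l)" "incident r (abs_cp2 l)"
    using incident_abs_iff[OF nz(1) l(1)] incident_abs_iff[OF nz(2) l(1)] incident_abs_iff[OF nz(3) l(1)] inc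
    by (simp_all add: abs_rep_cp2)
  ultimately show ?thesis using p by blast
qed

text \<open>Cramer's rule in the form of the linear relation between four vectors.\<close>

lemma det3_cramer:
  "det3 b c d *s a - det3 a c d *s b + det3 a b d *s c - det3 a b c *s d = 0"
  by (simp add: vec_eq_iff forall_3 det_3 algebra_simps)


section \<open>The matrix of a spherical CR tetrahedron\<close>

text \<open>Lifts of the vertices to null vectors, together with the genericity that the absence of C-circles
gives.\<close>

definition null_representatives :: "(4 \<Rightarrow> flag) \<Rightarrow> (4 \<Rightarrow> complex^3) \<Rightarrow> bool" where
  "null_representatives T x \<longleftrightarrow>
    (\<forall>i. x i \<noteq> 0) \<and> T = (\<lambda>i. (abs_cp2 (x i), abs_cp2 (polar (x i)))) \<and>
    (\<forall>i. herm (x i) (x i) = 0) \<and> (\<forall>i j. i \<noteq> j \<longrightarrow> herm (x i) (x j) \<noteq> 0) \<and>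
    (\<forall>i j k. i \<noteq> j \<longrightarrow> j \<noteq> k \<longrightarrow> i \<noteq> k \<longrightarrow> det3 (x i) (x j) (x k) \<noteq> 0)"

lemma null_representatives_exist:
  assumes "spherical_CR_tetrahedron T"
  obtains x where "null_representatives T x"
proof -
  obtain p where p: "range p \<subseteq> S3" "inj p" "T = (\<lambda>i. CR_flag (p i))"
    and C: "\<And>i j k. i \<noteq> j \<Longrightarrow> j \<noteq> k \<Longrightarrow> i \<noteq> k \<Longrightarrow> \<not> (\<exists>C. is_C_circle C \<and> {p i, p j, p k} \<subseteq> C)"
    using assms unfolding spherical_CR_tetrahedron_def generic_points_def by metis
  define x where "x = (\<lambda>i. rep_cp2 (p i))"
  have S: "p i \<in> S3" for i using p(1) by blast
  have x: "x i \<noteq> 0" "abs_cp2 (x i) = p i" "hform (x i) = 0" for i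
    using S[of i] by (simp_all add: x_def rep_cp2_nonzero abs_rep_cp2 S3_def)
  have "CR_flag (p i) = (abs_cp2 (x i), abs_cp2 (polar (x i)))" for i
    using tangent_line_abs[OF x(1), of i] S[of i] by (simp add: CR_flag_def x(2))
  then have T: "T = (\<lambda>i. (abs_cp2 (x i), abs_cp2 (polar (x i))))" by (simp add: p(3))
  have h: "herm (x i) (x j) \<noteq> 0" if "i \<noteq> j" for i j
  proof (rule herm_null_vectors_nonzero[OF x(1) x(3) x(1) x(3)])
    fix c show "x j \<noteq> c *s x i"
    proof
      assume *: "x j = c *s x i"
      then have "c \<noteq> 0" using x(1)[of j] by auto
      then have "p i = p j" using abs_cp2_eq_iff[OF x(1)[of i] x(1)[of j]] * x(2) by metis
      then show False using that p(2) by (simp add: inj_eq)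
    qed
  qed
  have d: "det3 (x i) (x j) (x k) \<noteq> 0" if "i \<noteq> j" "j \<noteq> k" "i \<noteq> k" for i j k
    using C_circle_through_dependent[OF S S S, of i j k] C[OF that] that(1) p(2)
    unfolding x_def by (auto simp: inj_eq)
  have "null_representatives T x"
    unfolding null_representatives_def using x(1) T herm_self_eq_0[OF x(3)] h d by blast
  then show ?thesis by (rule that)
qed

text \<open>Since the matrix is Hermitian, its column sums vanish together with its row sums.  The minor of the
first three indices stands for all principal minors of size three, which agree.\<close>

definition zero_line_sum_matrix :: "(4 \<Rightarrow> flag) \<Rightarrow> (4 \<Rightarrow> 4 \<Rightarrow> complex) \<Rightarrow> bool" where
  "zero_line_sum_matrix T B \<longleftrightarrow>
    (\<forall>i j. cnj (B i j) = B j i) \<and> (\<forall>i. B i i = 0) \<and> (\<forall>i j. i \<noteq> j \<longrightarrow> B i j \<noteq> 0) \<and>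
    (\<forall>i. B i 1 + B i 2 + B i 3 + B i 4 = 0) \<and>
    B 1 2 * B 2 3 * B 3 1 + B 1 3 * B 3 2 * B 2 1 \<noteq> 0 \<and>
    (\<forall>i j k. i \<noteq> j \<longrightarrow> j \<noteq> k \<longrightarrow> i \<noteq> k \<longrightarrow>
       z_face T i j k = (B i j * B j k * B k i) / (B i k * B j i * B k j)) \<and>
    z_edge T 1 2 = - B 1 3 / B 1 4 \<and> z_edge T 2 1 = - B 2 4 / B 2 3 \<and>
    z_edge T 3 4 = - B 3 1 / B 3 2 \<and> z_edge T 4 3 = - B 4 2 / B 4 1"

text \<open>Take \<open>B i j = cnj (l i) * \<langle>x i, x j\<rangle> * l j\<close>, where \<open>l\<close> consists of the coefficients of the linear
relation between the \<open>x i\<close>.  These are signed determinants, so that the quotients of determinants in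
\<^const>\<open>z_edge\<close> are quotients of the weights.\<close>

lemma zero_line_sum_matrix_exists:
  assumes "spherical_CR_tetrahedron T"
  obtains B where "zero_line_sum_matrix T B"
proof -
  obtain x where X: "null_representatives T x"
    by (rule null_representatives_exist[OF assms])
  note reps = X[unfolded null_representatives_def]
  note x = reps[THEN conjunct1, rule_format]
    and T = reps[THEN conjunct2, THEN conjunct1]
    and h0 = reps[THEN conjunct2, THEN conjunct2, THEN conjunct1, rule_format]
    and h = reps[THEN conjunct2, THEN conjunct2, THEN conjunct2, THEN conjunct1, rule_format]
    and d = reps[THEN conjunct2, THEN conjunct2, THEN conjunct2, THEN conjunct2, rule_format]
  define l :: "4 \<Rightarrow> complex" where
    "l = (\<lambda>i. if i = 1 then det3 (x 2) (x 3) (x 4) else if i = 2 then - det3 (x 1) (x 3) (x 4)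
       else if i = 3 then det3 (x 1) (x 2) (x 4) else - det3 (x 1) (x 2) (x 3))"
  have l: "l 1 = det3 (x 2) (x 3) (x 4)" "l 2 = - det3 (x 1) (x 3) (x 4)"
    "l 3 = det3 (x 1) (x 2) (x 4)" "l 4 = - det3 (x 1) (x 2) (x 3)"
    using neq4 by (simp_all add: l_def)
  have "l 1 \<noteq> 0" "l 2 \<noteq> 0" "l 3 \<noteq> 0" "l 4 \<noteq> 0"
    unfolding l using d neq4 by simp_all
  then have lnz: "l i \<noteq> 0" for i using exhaust_4[of i] by auto
  define B where "B = (\<lambda>i j. cnj (l i) * herm (x i) (x j) * l j)"
  have edge: "z_edge T i j = - B i k / B i m"
    if "even_order i j k m" and "det3 (x i) (x j) (x m) * l m = - (det3 (x i) (x j) (x k) * l k)"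
    for i j k m
  proof -
    have dist: "distinct [i, j, k, m]" using that(1) by (simp add: even_order_perm4)
    then have nz: "det3 (x i) (x j) (x k) \<noteq> 0" "herm (x i) (x m) \<noteq> 0"
      using d h by auto
    have "z_edge T i j = (herm (x i) (x k) * det3 (x i) (x j) (x m)) / (herm (x i) (x m) * det3 (x i) (x j) (x k))"
      unfolding T by (rule z_edge_reps[OF that(1)]) (simp_all add: x polar_nonzero)
    also have "\<dots> = - B i k / B i m"
    proof -
      have "det3 (x i) (x j) (x m) = - (det3 (x i) (x j) (x k) * l k) / l m"
        using that(2) lnz[of m] by (metis nonzero_mult_div_cancel_right)
      then show ?thesis using nz lnz by (simp add: B_def ac_simps)
    qed
    finally show ?thesis .
  qed
  have "zero_line_sum_matrix T B"
    unfolding zero_line_sum_matrix_def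
  proof (intro conjI allI impI)
    show "cnj (B i j) = B j i" for i j by (simp add: B_def cnj_herm)
    show "B i i = 0" for i by (simp add: B_def h0)
    show "B i j \<noteq> 0" if "i \<noteq> j" for i j using h[OF that] lnz by (simp add: B_def)
    show "B i 1 + B i 2 + B i 3 + B i 4 = 0" for i
    proof -
      have "herm (x i) (l 1 *s x 1 + l 2 *s x 2 + l 3 *s x 3 + l 4 *s x 4) = 0"
        using det3_cramer[of "x 2" "x 3" "x 4" "x 1"] unfolding l by (simp add: scalar_product_3)
      then have "cnj (l i) * herm (x i) (l 1 *s x 1 + l 2 *s x 2 + l 3 *s x 3 + l 4 *s x 4) = 0" by simp
      then show ?thesis by (simp add: B_def scalar_product_3 algebra_simps)
    qed
    have "B 1 2 * B 2 3 * B 3 1 + B 1 3 * B 3 2 * B 2 1 =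
      (l 1 * cnj (l 1)) * (l 2 * cnj (l 2)) * (l 3 * cnj (l 3)) *
      (herm (x 1) (x 2) * herm (x 2) (x 3) * herm (x 3) (x 1) + herm (x 1) (x 3) * herm (x 2) (x 1) * herm (x 3) (x 2))"
      by (simp add: B_def algebra_simps)
    also have "\<dots> \<noteq> 0"
      using lnz d[of 1 2 3] neq4 unfolding det3_polar_gram[OF h0 h0 h0] by simp
    finally show "B 1 2 * B 2 3 * B 3 1 + B 1 3 * B 3 2 * B 2 1 \<noteq> 0" .
    show "z_face T i j k = (B i j * B j k * B k i) / (B i k * B j i * B k j)"
      if "i \<noteq> j" "j \<noteq> k" "i \<noteq> k" for i j k
    proof -
      have "z_face T i j k = (herm (x i) (x j) * herm (x j) (x k) * herm (x k) (x i)) /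
          (herm (x i) (x k) * herm (x j) (x i) * herm (x k) (x j))"
        unfolding T by (rule z_face_reps) (simp_all add: x polar_nonzero)
      moreover define L where "L = (l i * cnj (l i)) * (l j * cnj (l j)) * (l k * cnj (l k))"
      moreover have "B i j * B j k * B k i = (herm (x i) (x j) * herm (x j) (x k) * herm (x k) (x i)) * L"
        "B i k * B j i * B k j = (herm (x i) (x k) * herm (x j) (x i) * herm (x k) (x j)) * L"
        by (simp_all add: B_def L_def ac_simps)
      moreover have "L \<noteq> 0" using lnz by (simp add: L_def)
      ultimately show ?thesis by simp
    qed
    have reorder: "det3 (x 2) (x 1) (x 3) = - det3 (x 1) (x 2) (x 3)" "det3 (x 2) (x 1) (x 4) = - det3 (x 1) (x 2) (x 4)"
      "det3 (x 3) (x 4) (x 1) = det3 (x 1) (x 3) (x 4)" "det3 (x 3) (x 4) (x 2) = det3 (x 2) (x 3) (x 4)"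
      "det3 (x 4) (x 3) (x 1) = - det3 (x 1) (x 3) (x 4)" "det3 (x 4) (x 3) (x 2) = - det3 (x 2) (x 3) (x 4)"
      by (simp_all add: det_3 algebra_simps)
    show "z_edge T 1 2 = - B 1 3 / B 1 4"
    proof (rule edge)
      show "even_order 1 2 3 4" by (simp add: even_order_iff)
    qed (simp only: l, simp)
    show "z_edge T 2 1 = - B 2 4 / B 2 3"
    proof (rule edge)
      show "even_order 2 1 4 3" by (simp add: even_order_iff)
    qed (simp only: l reorder, simp)
    show "z_edge T 3 4 = - B 3 1 / B 3 2"
    proof (rule edge)
      show "even_order 3 4 1 2" by (simp add: even_order_iff)
    qed (simp only: l reorder, simp)
    show "z_edge T 4 3 = - B 4 2 / B 4 1"
    proof (rule edge)
      show "even_order 4 3 2 1" by (simp add: even_order_iff)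
    qed (simp only: l reorder, simp)
  qed
  then show ?thesis by (rule that)
qed


section \<open>Conjugation of one tetrahedron and cancellation over the faces\<close>

text \<open>The vertices of the face opposite to \<open>v\<close> are listed in the boundary orientation.\<close>

definition face_bracket :: "(4 \<Rightarrow> flag) \<Rightarrow> 4 \<Rightarrow> bloch" where
  "face_bracket T v =
     (if v = 1 then bracket (- z_face T 2 3 4) else if v = 2 then bracket (- z_face T 1 4 3)
      else if v = 3 then bracket (- z_face T 1 2 4) else bracket (- z_face T 1 3 2))"

lemma z_face_rotate: "z_face T j k i = z_face T i j k"
  by (simp add: z_face_def ac_simps)

lemma z_face_flip: "z_face T i k j = 1 / z_face T i j k"
  by (simp add: z_face_def ac_simps)

lemma face_bracket_even_order:
  assumes "even_order v i j k"
  shows "face_bracket T v = bracket (- z_face T i j k)"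
  using assms neq4 z_face_rotate[of T] unfolding even_order_iff
  by (elim insertE emptyE; simp add: face_bracket_def; metis z_face_rotate)

text \<open>The rotation and inversion rules for brackets bring the coordinates of the tetrahedron, and those of the
transposed matrix for its conjugate, into the form of \<open>tetrahedron_identity\<close>.\<close>

lemma CR_tetrahedron_conj_difference:
  assumes "spherical_CR_tetrahedron T"
  shows "{z_edge T 1 2, z_edge T 2 1, z_edge T 3 4, z_edge T 4 3} \<inter> {0, 1} = {}"
    and "(bracket (z_edge T 1 2) + bracket (z_edge T 2 1) + bracket (z_edge T 3 4) + bracket (z_edge T 4 3))
      - (bracket (cnj (z_edge T 1 2)) + bracket (cnj (z_edge T 2 1)) + bracket (cnj (z_edge T 3 4)) + bracket (cnj (z_edge T 4 3)))
      = - (\<Sum>v\<in>UNIV. face_bracket T v)"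
proof -
  obtain B where B: "zero_line_sum_matrix T B" by (rule zero_line_sum_matrix_exists[OF assms(1)])
  note B' = B[unfolded zero_line_sum_matrix_def]
  note cnj = B'[THEN conjunct1, rule_format]
    and diag = B'[THEN conjunct2, THEN conjunct1, rule_format]
    and offdiag = B'[THEN conjunct2, THEN conjunct2, THEN conjunct1, rule_format]
    and row = B'[THEN conjunct2, THEN conjunct2, THEN conjunct2, THEN conjunct1, rule_format]
    and minor = B'[THEN conjunct2, THEN conjunct2, THEN conjunct2, THEN conjunct2, THEN conjunct1]
    and face = B'[THEN conjunct2, THEN conjunct2, THEN conjunct2, THEN conjunct2, THEN conjunct2, THEN conjunct1, rule_format]
    and edge = B'[THEN conjunct2, THEN conjunct2, THEN conjunct2, THEN conjunct2, THEN conjunct2, THEN conjunct2]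
  have rows: "B 1 2 + B 1 3 + B 1 4 = 0" "B 2 1 + B 2 3 + B 2 4 = 0" "B 3 1 + B 3 2 + B 3 4 = 0" "B 4 1 + B 4 2 + B 4 3 = 0"
    using row[of 1] row[of 2] row[of 3] row[of 4] unfolding diag by (simp_all only: add_0_left add_0_right)
  have cols: "B 2 1 + B 3 1 + B 4 1 = 0" "B 1 2 + B 3 2 + B 4 2 = 0" "B 1 3 + B 2 3 + B 4 3 = 0" "B 1 4 + B 2 4 + B 3 4 = 0"
    using rows[THEN arg_cong[of _ _ cnj]] by (simp_all only: complex_cnj_add cnj complex_cnj_zero)
  have nz: "B 1 2 \<noteq> 0" "B 1 3 \<noteq> 0" "B 1 4 \<noteq> 0" "B 2 1 \<noteq> 0" "B 2 3 \<noteq> 0" "B 2 4 \<noteq> 0"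
    "B 3 1 \<noteq> 0" "B 3 2 \<noteq> 0" "B 3 4 \<noteq> 0" "B 4 1 \<noteq> 0" "B 4 2 \<noteq> 0" "B 4 3 \<noteq> 0"
    by (rule offdiag; use neq4 in simp)+
  have z: "z_edge T 1 2 \<notin> {0, 1}" "z_edge T 2 1 \<notin> {0, 1}" "z_edge T 3 4 \<notin> {0, 1}" "z_edge T 4 3 \<notin> {0, 1}"
    unfolding edge[THEN conjunct1] edge[THEN conjunct2, THEN conjunct1]
      edge[THEN conjunct2, THEN conjunct2, THEN conjunct1] edge[THEN conjunct2, THEN conjunct2, THEN conjunct2]
    using neg_ratio_not_0_1[OF _ nz(2,3,1)] neg_ratio_not_0_1[OF _ nz(6,5,4)] neg_ratio_not_0_1[OF _ nz(7,8,9)]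
      neg_ratio_not_0_1[OF _ nz(11,10,12)] rows by (simp_all only: ac_simps simp_thms)
  show "{z_edge T 1 2, z_edge T 2 1, z_edge T 3 4, z_edge T 4 3} \<inter> {0, 1} = {}" using z by blast
  show "(bracket (z_edge T 1 2) + bracket (z_edge T 2 1) + bracket (z_edge T 3 4) + bracket (z_edge T 4 3))
      - (bracket (cnj (z_edge T 1 2)) + bracket (cnj (z_edge T 2 1)) + bracket (cnj (z_edge T 3 4)) + bracket (cnj (z_edge T 4 3)))
      = - (\<Sum>v\<in>UNIV. face_bracket T v)"
  proof -
    have zs: "z_edge T 1 2 = - B 1 3 / B 1 4" "z_edge T 2 1 = - B 2 4 / B 2 3"
      "z_edge T 3 4 = - B 3 1 / B 3 2" "z_edge T 4 3 = - B 4 2 / B 4 1"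
      using edge by blast+
    have czs: "cnj (z_edge T 1 2) = - B 3 1 / B 4 1" "cnj (z_edge T 2 1) = - B 4 2 / B 3 2"
      "cnj (z_edge T 3 4) = - B 1 3 / B 2 3" "cnj (z_edge T 4 3) = - B 2 4 / B 1 4"
      unfolding zs by (simp_all add: cnj)
    have face_flip: "bracket (- z_face T i k j) = - bracket (- z_face T i j k)"
      if "i \<noteq> j" "j \<noteq> k" "i \<noteq> k" for i j k
    proof -
      have "z_face T i j k \<noteq> 0" 
        unfolding face[OF that] using that that[symmetric] by (simp add: offdiag)
      then show ?thesis using bracket_inverse[of "- z_face T i j k"] z_face_flip[of T i k j] by simp
    qed
    have "bracket (z_edge T 1 2) = bracket (- B 1 2 / B 1 3)" "bracket (z_edge T 2 1) = - bracket (- B 2 1 / B 2 3)"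
      "bracket (z_edge T 4 3) = - bracket (- B 4 1 / B 4 2)"
      unfolding zs using bracket_neg_ratio_rotate[OF rows(1)] bracket_neg_ratio_rotate[OF rows(2)] bracket_neg_ratio_flip[of "B 2 4" "B 2 3"]
        bracket_neg_ratio_flip[of "B 4 2" "B 4 1"] rows nz by (simp_all add: ac_simps)
    moreover have "bracket (cnj (z_edge T 1 2)) = bracket (- B 2 1 / B 3 1)"
      "bracket (cnj (z_edge T 2 1)) = - bracket (- B 1 2 / B 3 2)"
      "bracket (cnj (z_edge T 4 3)) = - bracket (- B 1 4 / B 2 4)"
      unfolding czs using bracket_neg_ratio_rotate[OF cols(1)] bracket_neg_ratio_rotate[OF cols(2)] bracket_neg_ratio_flip[of "B 4 2" "B 3 2"]
        bracket_neg_ratio_flip[of "B 2 4" "B 1 4"] cols nz by (simp_all add: ac_simps)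
    moreover have "- (\<Sum>v\<in>UNIV. face_bracket T v) = bracket (- z_face T 1 2 3) - bracket (- z_face T 1 2 4)
        + bracket (- z_face T 1 3 4) - bracket (- z_face T 2 3 4)"
      using face_flip[of 1 2 3] face_flip[of 1 3 4] neq4 by (simp add: sum_4 face_bracket_def)
    moreover have "z_face T 1 2 3 = (B 1 2 * B 2 3 * B 3 1) / (B 1 3 * B 3 2 * B 2 1)"
      "z_face T 1 2 4 = (B 1 2 * B 2 4 * B 4 1) / (B 1 4 * B 4 2 * B 2 1)"
      "z_face T 1 3 4 = (B 1 3 * B 3 4 * B 4 1) / (B 1 4 * B 4 3 * B 3 1)"
      "z_face T 2 3 4 = (B 2 3 * B 3 4 * B 4 2) / (B 2 4 * B 4 3 * B 3 2)"
      using face neq4 by (simp_all add: ac_simps)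
    ultimately show ?thesis
      using tetrahedron_identity[OF rows cols nz refl minor] unfolding czs(3) unfolding zs(3)
      by (simp add: algebra_simps)
  qed
qed

text \<open>The terms are cancelled pair by pair.  Reindexing along the involution would only show that twice
the sum vanishes.\<close>

lemma sum_fixpoint_free_involution:
  fixes g :: "'a \<Rightarrow> 'b::ab_group_add"
  assumes "finite S" and "\<And>a. a \<in> S \<Longrightarrow> f a \<in> S" "\<And>a. a \<in> S \<Longrightarrow> f a \<noteq> a" "\<And>a. a \<in> S \<Longrightarrow> f (f a) = a"
    and "\<And>a. a \<in> S \<Longrightarrow> g (f a) = - g a"
  shows "sum g S = 0"
  using assms
proof (induction "card S" arbitrary: S rule: less_induct)
  case less
  show ?case
  proof (cases "S = {}")
    case False
    then obtain a where a: "a \<in> S" by blast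
    let ?S' = "S - {a, f a}"
    note fS = less.prems(2) and ff = less.prems(4)
    have "sum g ?S' = 0"
    proof (rule less.hyps)
      show "card ?S' < card S" using a less.prems(1) by (intro psubset_card_mono) auto
      show "f b \<in> ?S'" if "b \<in> ?S'" for b
      proof -
        have b: "b \<in> S" "b \<noteq> a" "b \<noteq> f a" using that by auto
        have "f b \<noteq> a" using ff[OF b(1)] b(3) by auto
        moreover have "f b \<noteq> f a" using ff[OF b(1)] ff[OF a] b(2) by auto
        ultimately show ?thesis using fS[OF b(1)] by simp
      qed
    qed (use less.prems in auto)
    moreover have "sum g S = g a + (g (f a) + sum g ?S')"
    proof -
      have "sum g S = g a + sum g (S - {a})" using a less.prems(1) by (rule sum.remove[rotated])
      also have "sum g (S - {a}) = g (f a) + sum g (S - {a} - {f a})"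
        using a fS[OF a] less.prems(1) less.prems(3)[OF a] by (intro sum.remove) auto
      also have "S - {a} - {f a} = ?S'" by auto
      finally show ?thesis .
    qed
    ultimately show ?thesis using less.prems(5)[OF a] by simp
  qed simp
qed

text \<open>An odd gluing map reverses the boundary orientation, as does the exchange of the last two vertices.\<close>

lemma odd_map_even_order:
  assumes "\<sigma> permutes UNIV" "\<not> evenperm \<sigma>" "even_order v i j k"
  shows "even_order (\<sigma> v) (\<sigma> i) (\<sigma> k) (\<sigma> j)"
proof -
  have d: "distinct [v, i, j, k]" and e: "evenperm (perm4 v i j k)"
    using assms(3) by (simp_all add: even_order_perm4)
  have "distinct [v, i, k, j]" using d by auto
  from perm4_permutes[OF this] have p: "permutation (perm4 v i k j)"
    by (auto simp: permutation_permutes)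
  have "\<not> evenperm (perm4 v i k j)" using perm4_swap(3)[OF d] e by simp
  moreover have "permutation \<sigma>" using assms(1) by (auto simp: permutation_permutes)
  ultimately have "evenperm (\<sigma> \<circ> perm4 v i k j)"
    using assms(2) p by (simp add: evenperm_comp)
  moreover have "\<sigma> \<circ> perm4 v i k j = perm4 (\<sigma> v) (\<sigma> i) (\<sigma> k) (\<sigma> j)"
    by (simp add: fun_eq_iff perm4_def)
  moreover have "distinct [\<sigma> v, \<sigma> i, \<sigma> k, \<sigma> j]"
    using d permutes_inj[OF assms(1)] by (auto simp: inj_eq)
  ultimately show ?thesis by (simp add: even_order_perm4)
qed

lemma even_order_exists: obtains i j k where "even_order v i j k"
proof -
  consider "v = 1" | "v = 2" | "v = 3" | "v = 4" using exhaust_4[of v] by blast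
  then show ?thesis
    by cases (rule that[of 2 3 4] that[of 1 4 3] that[of 1 2 4] that[of 1 3 2]; simp add: even_order_iff; fail)+
qed

lemma face_bracket_glued:
  assumes "ideal_triangulation K" "face_compatible K T" "pairing K (\<nu>, v) = Some (\<nu>', \<sigma>)"
  shows "face_bracket (T \<nu>') (\<sigma> v) = - face_bracket (T \<nu>) v"
proof -
  obtain i j k where o: "even_order v i j k" by (rule even_order_exists)
  have \<sigma>: "\<sigma> permutes UNIV" "\<not> evenperm \<sigma>"
    using assms(1,3) unfolding ideal_triangulation_def by blast+
  have z: "z_face (T \<nu>) i j k * z_face (T \<nu>') (\<sigma> i) (\<sigma> k) (\<sigma> j) = 1"
    using assms(2,3) o unfolding face_compatible_def by blast
  then have "- z_face (T \<nu>) i j k \<noteq> 0" "- z_face (T \<nu>') (\<sigma> i) (\<sigma> k) (\<sigma> j) = 1 / - z_face (T \<nu>) i j k"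
    by (auto simp: eq_divide_eq mult.commute)
  then show ?thesis
    using bracket_inverse face_bracket_even_order[OF o] face_bracket_even_order[OF odd_map_even_order[OF \<sigma> o]] by metis
qed

lemma sum_face_brackets:
  assumes "ideal_triangulation K" "no_boundary_faces K" "face_compatible K T"
  shows "(\<Sum>\<nu>\<in>simplices K. \<Sum>v\<in>UNIV. face_bracket (T \<nu>) v) = 0"
proof -
  let ?S = "simplices K \<times> (UNIV :: 4 set)"
  define f where "f = (\<lambda>(\<nu>, v). let (\<nu>', \<sigma>) = the (pairing K (\<nu>, v)) in (\<nu>', \<sigma> v))"
  have "(\<Sum>(\<nu>, v)\<in>?S. face_bracket (T \<nu>) v) = 0"
  proof (rule sum_fixpoint_free_involution[where f = f])
    fix a assume "a \<in> ?S"
    then have "a \<in> dom (pairing K)" using assms(2) by (simp add: no_boundary_faces_def)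
    then obtain \<nu> v \<nu>' \<sigma> where a: "a = (\<nu>, v)" "pairing K (\<nu>, v) = Some (\<nu>', \<sigma>)"
      by (metis domD surj_pair)
    have tri: "\<nu>' \<in> simplices K" "\<sigma> permutes UNIV" "(\<nu>', \<sigma> v) \<noteq> (\<nu>, v)"
      "pairing K (\<nu>', \<sigma> v) = Some (\<nu>, inv_into UNIV \<sigma>)"
      using assms(1) a(2) unfolding ideal_triangulation_def by blast+
    have fa: "f a = (\<nu>', \<sigma> v)" by (simp add: f_def a)
    show "f a \<in> ?S" "f a \<noteq> a" unfolding fa unfolding a(1) using tri by simp_all
    show "f (f a) = a"
      unfolding fa unfolding a(1) using permutes_inj[OF tri(2)] by (simp add: f_def tri(4))
    show "(case f a of (\<nu>, v) \<Rightarrow> face_bracket (T \<nu>) v) = - (case a of (\<nu>, v) \<Rightarrow> face_bracket (T \<nu>) v)"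
      unfolding fa unfolding a(1) using face_bracket_glued[OF assms(1,3) a(2)] by simp
  qed (simp add: simplices_def)
  then show ?thesis by (simp add: sum.cartesian_product)
qed


section \<open>The dilogarithm integral\<close>

definition slit_plane :: "complex set" where
  "slit_plane = {z. 1 - z \<notin> \<real>\<^sub>\<le>\<^sub>0}"

text \<open>The integrand of the dilogarithm with its removable singularity at \<open>0\<close> filled in.\<close>

definition log_quotient :: "complex \<Rightarrow> complex" where
  "log_quotient t = (if t = 0 then -1 else Ln (1 - t) / t)"

text \<open>On the slit plane this is \<open>- Li\<^sub>2(z)\<close>.\<close>

definition log_primitive :: "complex \<Rightarrow> complex" where
  "log_primitive z = contour_integral (linepath 0 z) log_quotient"

lemma mem_slit_plane_iff: "z \<in> slit_plane \<longleftrightarrow> Im z \<noteq> 0 \<or> Re z < 1"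
  by (auto simp: slit_plane_def complex_nonpos_Reals_iff)

lemma open_slit_plane: "open slit_plane"
proof -
  have eq: "slit_plane = {z. Im z \<noteq> 0} \<union> {z. Re z < 1}" by (auto simp: mem_slit_plane_iff)
  show ?thesis
    unfolding eq by (intro open_Un open_Collect_neq open_Collect_less continuous_intros)
qed

lemma closed_segment_0_subset_slit_plane:
  assumes "z \<in> slit_plane"
  shows "closed_segment 0 z \<subseteq> slit_plane"
proof
  fix w assume "w \<in> closed_segment 0 z"
  then obtain u where u: "0 \<le> u" "u \<le> 1" "w = u *\<^sub>R z" by (auto simp: in_segment)
  show "w \<in> slit_plane"
  proof (cases "u = 0 \<or> Im z \<noteq> 0")
    case False
    then have "Re z < 1" using assms by (simp add: mem_slit_plane_iff)
    then have "u * Re z < 1"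
      using u False by (smt (verit, best) mult_left_le_one_le mult_nonneg_nonpos)
    then show ?thesis using u by (simp add: mem_slit_plane_iff)
  qed (use u in \<open>auto simp: mem_slit_plane_iff\<close>)
qed

lemma holomorphic_log_quotient: "log_quotient holomorphic_on slit_plane"
proof (rule no_isolated_singularity)
  have "(\<lambda>t. Ln (1 - t) / t) holomorphic_on slit_plane - {0}"
    by (intro holomorphic_intros) (auto simp: slit_plane_def)
  then show "log_quotient holomorphic_on slit_plane - {0}"
    by (rule holomorphic_transform) (auto simp: log_quotient_def)
  have D: "((\<lambda>t. Ln (1 - t)) has_field_derivative -1) (at 0)"
    by (auto intro!: derivative_eq_intros)
  then have "((\<lambda>t. Ln (1 - t) / t) \<longlongrightarrow> -1) (at 0)"
    by (simp add: has_field_derivative_iff)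
  then have "isCont log_quotient 0"
    unfolding isCont_def log_quotient_def
    by (simp add: filterlim_cong[OF refl refl eventually_at_filter[THEN iffD2]] eventually_at_filter
        cong: if_cong) (rule Lim_transform_eventually, auto simp: eventually_at_filter)
  moreover have "isCont log_quotient z" if "z \<in> slit_plane - {0}" for z
  proof -
    have "continuous_on (slit_plane - {0}) log_quotient"
      using \<open>log_quotient holomorphic_on slit_plane - {0}\<close> holomorphic_on_imp_continuous_on by blast
    then show ?thesis
      using that open_slit_plane by (simp add: continuous_on_eq_continuous_at open_Diff)
  qed
  ultimately show "continuous_on slit_plane log_quotient"
    by (intro continuous_at_imp_continuous_on) blast
qed (auto simp: open_slit_plane)

lemma has_field_derivative_log_primitive:
  assumes "z \<in> slit_plane"
  shows "(log_primitive has_field_derivative log_quotient z) (at z)"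
  unfolding log_primitive_def
proof (rule triangle_contour_integrals_starlike_primitive[where S = slit_plane])
  show cont: "continuous_on slit_plane log_quotient"
    by (rule holomorphic_on_imp_continuous_on[OF holomorphic_log_quotient])
  fix b c :: complex
  assume bc: "closed_segment b c \<subseteq> slit_plane"
  have "starlike slit_plane"
    unfolding starlike_def using closed_segment_0_subset_slit_plane
    by (intro bexI[of _ 0]) (auto simp: mem_slit_plane_iff)
  then obtain F where F: "\<And>w. w \<in> slit_plane \<Longrightarrow> (F has_field_derivative log_quotient w) (at w)"
    using holomorphic_starlike_primitive[OF cont, of "{}"] holomorphic_log_quotient open_slit_plane
    by (metis Diff_empty finite.emptyI holomorphic_on_imp_differentiable_at open_slit_plane)
  have seg: "contour_integral (linepath u v) log_quotient = F v - F u"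
    if "closed_segment u v \<subseteq> slit_plane" for u v
  proof -
    have "(F has_field_derivative log_quotient w) (at w within slit_plane)" if "w \<in> slit_plane" for w
      by (rule has_field_derivative_at_within[OF F[OF that]])
    from contour_integral_primitive[OF this, where g = "linepath u v"]
    have "(log_quotient has_contour_integral F v - F u) (linepath u v)"
      using that by simp
    then show ?thesis by (rule contour_integral_unique)
  qed
  have ends: "b \<in> slit_plane" "c \<in> slit_plane" using bc by auto
  show "contour_integral (linepath 0 b) log_quotient + contour_integral (linepath b c) log_quotient
      + contour_integral (linepath c 0) log_quotient = 0"
    using seg[OF bc] seg[OF closed_segment_0_subset_slit_plane[OF ends(1)]]
      seg[of c 0] closed_segment_0_subset_slit_plane[OF ends(2)]
    by (simp add: closed_segment_commute)
qed (use assms closed_segment_0_subset_slit_plane open_slit_plane in \<open>auto simp: mem_slit_plane_iff\<close>)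

lemma Bloch_Wigner_eq_log_primitive:
  "Bloch_Wigner z = Im (Ln (1 - z)) * ln (cmod z) - Im (log_primitive z)" if "z \<noteq> 1"
proof -
  have "contour_integral (linepath 0 z) (\<lambda>t. Ln (1 - t) / t) = log_primitive z"
  proof (cases "z = 0")
    case False
    show ?thesis
      unfolding log_primitive_def contour_integral_integral
      by (rule integral_spike[of "{0}"])
        (use False in \<open>auto simp: log_quotient_def linepath_def\<close>)
  qed (simp add: log_primitive_def)
  then show ?thesis
    using that by (simp add: Bloch_Wigner_def Arg_eq_Im_Ln)
qed

lemma log_primitive_cnj:
  assumes "z \<in> slit_plane"
  shows "log_primitive (cnj z) = cnj (log_primitive z)"
proof -
  have "cnj \<circ> linepath 0 z = linepath 0 (cnj z)"
    by (auto simp: linepath_def)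
  then have "log_primitive (cnj z) = cnj (contour_integral (linepath 0 z) (cnj \<circ> log_quotient \<circ> cnj))"
    unfolding log_primitive_def using contour_integral_cnj[of "linepath 0 z" log_quotient] by simp
  also have "contour_integral (linepath 0 z) (cnj \<circ> log_quotient \<circ> cnj) = log_primitive z"
    unfolding log_primitive_def
  proof (rule contour_integral_cong)
    fix w assume "w \<in> path_image (linepath 0 z)"
    then have "w \<in> slit_plane" using closed_segment_0_subset_slit_plane[OF assms] by auto
    then have "cnj w \<in> slit_plane" by (simp add: mem_slit_plane_iff)
    then show "(cnj \<circ> log_quotient \<circ> cnj) w = log_quotient w"
      using cnj_Ln[of "1 - cnj w"] by (auto simp: log_quotient_def slit_plane_def)
  qed simp
  finally show ?thesis .
qed

lemma log_primitive_0: "log_primitive 0 = 0"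
  by (simp add: log_primitive_def)

lemma Im_log_primitive_real: "x < 1 \<Longrightarrow> Im (log_primitive (of_real x)) = 0"
  using log_primitive_cnj[of "of_real x"] by (simp add: mem_slit_plane_iff complex_eq_iff)

text \<open>A boundary term of the integral across the branch point \<open>1\<close>; the zero of the first factor outweighs the
logarithmic singularity of the second, whose imaginary part stays bounded.\<close>

lemma isCont_Ln_mult_Ln_1_minus:
  "isCont (\<lambda>u::real. Ln (of_real u) * Ln (1 - of_real u)) 1"
proof -
  have bound: "cmod (Ln (of_real u) * Ln (1 - of_real u)) \<le> \<bar>ln u\<bar> * (\<bar>ln \<bar>1 - u\<bar>\<bar> + pi)"
    if "u > 0" "u \<noteq> 1" for u :: real
  proof -
    have "cmod (Ln (1 - of_real u)) \<le> \<bar>Re (Ln (1 - of_real u))\<bar> + \<bar>Im (Ln (1 - of_real u))\<bar>"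
      by (rule cmod_le)
    also have "Re (Ln (1 - of_real u)) = ln \<bar>1 - u\<bar>"
    proof -
      have "cmod (1 - of_real u) = \<bar>1 - u\<bar>"
        by (metis norm_of_real of_real_1 of_real_diff)
      moreover have "1 - complex_of_real u \<noteq> 0" using that by simp
      ultimately show ?thesis by (simp only: Re_Ln not_False_eq_True)
    qed
    also have "\<bar>Im (Ln (1 - of_real u))\<bar> \<le> pi"
      using that mpi_less_Im_Ln[of "1 - of_real u"] Im_Ln_le_pi[of "1 - of_real u"] by (simp add: abs_le_iff)
    finally show ?thesis
      using that by (simp add: norm_mult Ln_of_real mult_left_mono)
  qed
  have "((\<lambda>u::real. \<bar>ln u\<bar> * (\<bar>ln \<bar>1 - u\<bar>\<bar> + pi)) \<longlongrightarrow> 0) (at_left 1)"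
    "((\<lambda>u::real. \<bar>ln u\<bar> * (\<bar>ln \<bar>1 - u\<bar>\<bar> + pi)) \<longlongrightarrow> 0) (at_right 1)"
    by real_asymp+
  then have "((\<lambda>u::real. \<bar>ln u\<bar> * (\<bar>ln \<bar>1 - u\<bar>\<bar> + pi)) \<longlongrightarrow> 0) (at 1)"
    by (rule filterlim_split_at)
  then have "((\<lambda>u::real. Ln (of_real u) * Ln (1 - of_real u)) \<longlongrightarrow> 0) (at 1)"
  proof (rule Lim_null_comparison[rotated])
    have "\<forall>\<^sub>F u::real in at 1. u \<in> {0<..} - {1}"
      by (intro eventually_at_in_open) auto
    then show "\<forall>\<^sub>F u::real in at 1. norm (Ln (of_real u) * Ln (1 - of_real u)) \<le> \<bar>ln u\<bar> * (\<bar>ln \<bar>1 - u\<bar>\<bar> + pi)"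
      by eventually_elim (use bound in auto)
  qed
  then show ?thesis by (simp add: isCont_def)
qed

lemma has_derivative_ln_cmod:
  assumes "z \<noteq> 0"
  shows "((\<lambda>z. ln (cmod z)) has_derivative (\<lambda>h. Re (h / z))) (at z)"
proof -
  have "((\<lambda>z. ln (cmod z)) has_derivative (\<lambda>h. inverse (cmod z) * inner h (sgn z))) (at z)"
    using has_derivative_ln[OF _ GDERIV_norm[OF assms, unfolded gderiv_def]] assms by (simp add: mult.commute)
  moreover have "inverse (cmod z) * inner h (sgn z) = Re (h / z)" for h
  proof -
    have "inverse (cmod z) * inner h (sgn z) = inner h z / (cmod z)\<^sup>2"
      by (simp add: sgn_div_norm power2_eq_square divide_inverse)
    also have "\<dots> = Re (h / z)"
      by (simp add: inner_complex_def Re_divide cmod_power2)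
    finally show ?thesis .
  qed
  ultimately show ?thesis by simp
qed

text \<open>This is \<open>log |z| d arg (1 - z) - log |1 - z| d arg z\<close>; being alternating in \<open>z\<close> and \<open>1 - z\<close>, it makes
both the reflection formula and the five-term relation a matter of linear algebra.\<close>

definition Bloch_Wigner_differential :: "complex \<Rightarrow> complex \<Rightarrow> real" where
  "Bloch_Wigner_differential z h = ln (cmod z) * Im (- h / (1 - z)) - ln (cmod (1 - z)) * Im (h / z)"

lemma has_derivative_Bloch_Wigner_slit:
  assumes "z \<in> slit_plane" "z \<noteq> 0"
  shows "(Bloch_Wigner has_derivative Bloch_Wigner_differential z) (at z)"
proof -
  have z1: "1 - z \<notin> \<real>\<^sub>\<le>\<^sub>0" using assms by (simp add: slit_plane_def)
  then have [simp]: "1 - z \<noteq> 0" "z \<noteq> 1" by auto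
  let ?f = "\<lambda>z. Im (Ln (1 - z)) * ln (cmod z) - Im (log_primitive z)"
  have 1: "((\<lambda>z. Im (Ln (1 - z))) has_derivative (\<lambda>h. Im (- h / (1 - z)))) (at z)"
  proof -
    have "((\<lambda>z. Ln (1 - z)) has_field_derivative - 1 / (1 - z)) (at z)"
      using z1 by (auto intro!: derivative_eq_intros simp: field_simps)
    from has_derivative_Im[OF this[unfolded has_field_derivative_def]] show ?thesis
      by (simp add: mult.commute)
  qed
  have 2: "((\<lambda>z. Im (log_primitive z)) has_derivative (\<lambda>h. Im (log_quotient z * h))) (at z)"
    using has_derivative_Im[OF has_field_derivative_log_primitive[OF assms(1), unfolded has_field_derivative_def]] .
  have "(?f has_derivative (\<lambda>h. Im (Ln (1 - z)) * Re (h / z) + Im (- h / (1 - z)) * ln (cmod z) - Im (log_quotient z * h))) (at z)"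
    by (intro has_derivative_diff has_derivative_mult 1 2 has_derivative_ln_cmod assms)
  also have "(\<lambda>h. Im (Ln (1 - z)) * Re (h / z) + Im (- h / (1 - z)) * ln (cmod z) - Im (log_quotient z * h)) = Bloch_Wigner_differential z"
  proof
    fix h
    have "Im (Ln (1 - z) * (h / z)) = Im (Ln (1 - z)) * Re (h / z) + ln (cmod (1 - z)) * Im (h / z)"
    proof -
      have "Im (a * b) = Im a * Re b + Re a * Im b" for a b by simp
      from this[of "Ln (1 - z)" "h / z"] show ?thesis by (simp only: Re_Ln \<open>1 - z \<noteq> 0\<close> not_False_eq_True)
    qed
    then show "Im (Ln (1 - z)) * Re (h / z) + Im (- h / (1 - z)) * ln (cmod z) - Im (log_quotient z * h) = Bloch_Wigner_differential z h"
      using assms(2) by (simp add: log_quotient_def Bloch_Wigner_differential_def mult.commute)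
  qed
  finally show ?thesis
  proof (rule has_derivative_transform_within_open)
    show "open slit_plane" by (rule open_slit_plane)
    show "?f w = Bloch_Wigner w" if "w \<in> slit_plane" for w
      using that by (subst Bloch_Wigner_eq_log_primitive) (auto simp: mem_slit_plane_iff)
  qed (rule assms(1))
qed

text \<open>The product \<open>Im (Ln (1 - z)) * ln |z|\<close> is of the size of \<open>|z| ln |z|\<close>.\<close>

lemma isCont_Bloch_Wigner_0: "isCont Bloch_Wigner 0"
proof -
  have eq: "Bloch_Wigner z = Im (log_quotient z * z) * ln (cmod z) - Im (log_primitive z)" if "z \<in> slit_plane" for z
    using that by (subst Bloch_Wigner_eq_log_primitive)
      (auto simp: mem_slit_plane_iff log_quotient_def simp del: times_complex.sel)
  have B0: "Bloch_Wigner 0 = 0" by (simp add: eq mem_slit_plane_iff log_primitive_0)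
  have 0: "(0::complex) \<in> slit_plane" by (simp add: mem_slit_plane_iff)
  have LP: "isCont log_primitive 0"
    using DERIV_isCont[OF has_field_derivative_log_primitive[OF 0]] .
  have LQ: "isCont log_quotient 0"
    using holomorphic_log_quotient 0 open_slit_plane holomorphic_on_imp_continuous_on
    by (metis continuous_on_eq_continuous_at)
  have xlnx: "((\<lambda>z::complex. cmod z * ln (cmod z)) \<longlongrightarrow> 0) (at 0)"
  proof -
    have "((\<lambda>r::real. r * ln r) \<longlongrightarrow> 0) (at_right 0)" by real_asymp
    moreover have "filterlim cmod (at_right 0) (at (0::complex))"
      by (auto simp: filterlim_at eventually_at_filter intro!: tendsto_eq_intros)
    ultimately show ?thesis by (rule filterlim_compose)
  qed
  have "((\<lambda>z. Im (log_quotient z * z) * ln (cmod z)) \<longlongrightarrow> 0) (at 0)"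
  proof (rule Lim_null_comparison)
    show "\<forall>\<^sub>F z in at 0. norm (Im (log_quotient z * z) * ln (cmod z)) \<le> cmod (log_quotient z) * \<bar>cmod z * ln (cmod z)\<bar>"
    proof (rule always_eventually, rule allI)
      fix z
      have "\<bar>Im (log_quotient z * z)\<bar> \<le> cmod (log_quotient z) * cmod z"
        by (metis abs_Im_le_cmod norm_mult)
      then show "norm (Im (log_quotient z * z) * ln (cmod z)) \<le> cmod (log_quotient z) * \<bar>cmod z * ln (cmod z)\<bar>"
        by (simp add: abs_mult mult_right_mono flip: mult.assoc)
    qed
    show "((\<lambda>z. cmod (log_quotient z) * \<bar>cmod z * ln (cmod z)\<bar>) \<longlongrightarrow> 0) (at 0)"
      using tendsto_mult[OF tendsto_norm[OF LQ[unfolded isCont_def]] tendsto_rabs[OF xlnx]] by simp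
  qed
  then have "((\<lambda>z. Im (log_quotient z * z) * ln (cmod z) - Im (log_primitive z)) \<longlongrightarrow> 0 - Im (log_primitive 0)) (at 0)"
    by (intro tendsto_intros LP[unfolded isCont_def])
  then have "(Bloch_Wigner \<longlongrightarrow> 0 - Im (log_primitive 0)) (at 0)"
    by (rule Lim_transform_within_open[OF _ open_slit_plane 0]) (simp add: eq)
  then show ?thesis by (simp add: isCont_def B0 log_primitive_0)
qed


section \<open>The Bloch-Wigner function\<close>

lemma Ln_of_real_neg:
  assumes "x < 0"
  shows "Ln (of_real x) = of_real (ln (- x)) + \<i> * pi"
  using Ln_of_real'[of x] assms by (simp add: mult.commute)

text \<open>For real \<open>x \<ge> 1\<close> the path of integration runs along the branch cut beyond \<open>1\<close>.  The integral is
computed from an antiderivative, on \<open>[0, 1/2]\<close> the primitive itself and on \<open>[1/2, x]\<close> its image under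
the reflection \<open>u \<mapsto> 1 - u\<close>, which remains continuous at the singular point.\<close>

lemma has_integral_Ln_1_minus_quotient:
  assumes "x \<ge> 1"
  shows "((\<lambda>u. Ln (1 - of_real u) / of_real u) has_integral
     log_primitive (1 / 2) + (Ln (of_real x) * Ln (1 - of_real x) - log_primitive (1 - of_real x)
       - (Ln (1 / 2) * Ln (1 / 2) - log_primitive (1 / 2)))) {0..x}"
proof (rule has_integral_combine)
  have slit: "of_real u \<in> slit_plane" if "u < 1" for u
    using that by (simp add: mem_slit_plane_iff)
  have "((\<lambda>u. Ln (1 - of_real u) / of_real u) has_integral
      (log_primitive (of_real (1 / 2)) - log_primitive (of_real 0))) {0..1 / 2}"
  proof (rule fundamental_theorem_of_calculus_interior_strong[of "{}"])
    fix u :: real assume u: "u \<in> {0<..<1 / 2} - {}"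
    then show "((\<lambda>u. log_primitive (of_real u)) has_vector_derivative Ln (1 - of_real u) / of_real u) (at u)"
      using has_field_derivative_log_primitive[OF slit[of u]]
      by (intro has_vector_derivative_real_field) (auto simp: log_quotient_def)
  next
    have "isCont (\<lambda>u. log_primitive (of_real u)) u" if "u < 1" for u :: real
      using DERIV_isCont[OF has_field_derivative_log_primitive[OF slit[OF that]]]
      by (intro isCont_o2[where g = log_primitive and f = of_real]) simp_all
    then show "continuous_on {0..1 / 2} (\<lambda>u. log_primitive (of_real u))"
      by (intro continuous_at_imp_continuous_on) auto
  qed auto
  then show "((\<lambda>u. Ln (1 - of_real u) / of_real u) has_integral log_primitive (1 / 2)) {0..1 / 2}"
    by (simp add: log_primitive_0)
  let ?H = "\<lambda>u::real. Ln (of_real u) * Ln (1 - of_real u) - log_primitive (1 - of_real u)"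
  have der: "(?H has_vector_derivative Ln (1 - of_real u) / of_real u) (at u)" if u: "0 < u" "u \<noteq> 1" for u
  proof -
    have 1: "((\<lambda>u. Ln (of_real u)) has_vector_derivative 1 / of_real u) (at u)"
      using u by (intro has_vector_derivative_real_field) (auto intro!: derivative_eq_intros simp: field_simps)
    have 2: "((\<lambda>u. Ln (1 - of_real u)) has_vector_derivative - 1 / (1 - of_real u)) (at u)"
    proof (cases "u < 1")
      case True
      then show ?thesis
        by (intro has_vector_derivative_real_field[of "\<lambda>z. Ln (1 - z)"])
          (auto intro!: derivative_eq_intros simp: field_simps complex_nonpos_Reals_iff)
    next
      case False
      have eq: "Ln (1 - of_real w) = of_real (ln (w - 1)) + \<i> * pi" if "w \<in> {1<..}" for w
        using Ln_of_real_neg[of "1 - w"] that by simp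
      have "((\<lambda>w. of_real (ln (w - 1)) + \<i> * pi) has_vector_derivative of_real (1 / (u - 1))) (at u)"
        using False u by (auto intro!: derivative_eq_intros has_vector_derivative_of_real
          simp flip: has_real_derivative_iff_has_vector_derivative)
      then have "((\<lambda>u. Ln (1 - of_real u)) has_vector_derivative of_real (1 / (u - 1))) (at u)"
        by (rule has_vector_derivative_transform_within_open[of _ _ _ "{1<..}"]) (use False u eq in auto)
      also have "complex_of_real (1 / (u - 1)) = - 1 / (1 - of_real u)"
        using u by (simp add: field_simps)
      finally show ?thesis .
    qed
    have 3: "((\<lambda>u. log_primitive (1 - of_real u)) has_vector_derivative - Ln (of_real u) / (1 - of_real u)) (at u)"
    proof (intro has_vector_derivative_real_field[of "\<lambda>z. log_primitive (1 - z)"])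
      have s: "1 - of_real u \<in> slit_plane" using slit[of "1 - u"] u by simp
      have "((\<lambda>z. log_primitive (1 - z)) has_field_derivative log_quotient (1 - of_real u) * (-1)) (at (of_real u))"
        using has_field_derivative_log_primitive[OF s]
        by (rule DERIV_chain2[where f = log_primitive and g = "\<lambda>z. 1 - z"]) (auto intro!: derivative_eq_intros)
      then show "((\<lambda>z. log_primitive (1 - z)) has_field_derivative - Ln (of_real u) / (1 - of_real u)) (at (of_real u))"
        using u by (simp add: log_quotient_def)
    qed
    have "(?H has_vector_derivative (Ln (of_real u) * (- 1 / (1 - of_real u)) + 1 / of_real u * Ln (1 - of_real u)
        - (- Ln (of_real u) / (1 - of_real u)))) (at u)"
      by (intro has_vector_derivative_diff has_vector_derivative_mult 1 2 3)
    then show ?thesis by simp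
  qed
  have "((\<lambda>u. Ln (1 - of_real u) / of_real u) has_integral (?H x - ?H (1 / 2))) {1 / 2..x}"
  proof (rule fundamental_theorem_of_calculus_interior_strong[of "{1}"])
    fix u :: real assume "u \<in> {1 / 2<..<x} - {1}"
    then show "(?H has_vector_derivative Ln (1 - of_real u) / of_real u) (at u)"
      by (intro der) auto
  next
    have "isCont ?H u" if u: "0 < u" for u
    proof (cases "u = 1")
      case True
      have s: "1 - of_real 1 \<in> slit_plane" by (simp add: mem_slit_plane_iff)
      have "isCont (\<lambda>u. log_primitive (1 - of_real u)) (1::real)"
        using DERIV_isCont[OF has_field_derivative_log_primitive[OF s]]
        by (intro isCont_o2[where g = log_primitive and f = "\<lambda>u. 1 - of_real u"]) simp_all
      with isCont_Ln_mult_Ln_1_minus show ?thesis unfolding True by (rule isCont_diff)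
    qed (rule has_vector_derivative_continuous[OF der[OF u]])
    then show "continuous_on {1 / 2..x} ?H"
      by (intro continuous_at_imp_continuous_on) auto
  qed (use assms in auto)
  then show "((\<lambda>u. Ln (1 - of_real u) / of_real u) has_integral
      (Ln (of_real x) * Ln (1 - of_real x) - log_primitive (1 - of_real x)
       - (Ln (1 / 2) * Ln (1 / 2) - log_primitive (1 / 2)))) {1 / 2..x}"
    by simp
qed (use assms in auto)

text \<open>Beyond the branch point the imaginary part of the integral is \<open>\<pi> ln x\<close>, and this is also the value of
the first summand.\<close>

lemma Bloch_Wigner_real: "Bloch_Wigner (of_real x) = 0"
proof (cases "x < 1")
  case True
  then have "Im (Ln (1 - of_real x)) = 0"
    using Ln_of_real[of "1 - x"] by simp
  then show ?thesis
    using True Im_log_primitive_real by (subst Bloch_Wigner_eq_log_primitive) auto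
next
  case False
  let ?f = "\<lambda>u. Ln (1 - u) / u"
  have "contour_integral (linepath 0 (of_real x)) ?f = integral {0..x} (\<lambda>u. Ln (1 - of_real u) / of_real u)"
    using False contour_integral_linepath_Reals_eq[of 0 "of_real x" ?f] by simp
  also have "\<dots> = log_primitive (1 / 2) + (Ln (of_real x) * Ln (1 - of_real x) - log_primitive (1 - of_real x)
       - (Ln (1 / 2) * Ln (1 / 2) - log_primitive (1 / 2)))"
    using False by (intro integral_unique has_integral_Ln_1_minus_quotient) simp
  also have "Im \<dots> = ln x * Arg (1 - of_real x)"
  proof -
    have "Im (log_primitive (1 / 2)) = 0" "Im (log_primitive (1 - of_real x)) = 0"
      using Im_log_primitive_real[of "1 / 2"] Im_log_primitive_real[of "1 - x"] False by simp_all
    moreover have "Im (Ln (1 / 2) * Ln (1 / 2)) = 0"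
      using Ln_of_real[of "1 / 2"] by simp
    moreover have "Im (Ln (of_real x) * Ln (1 - of_real x)) = ln x * Arg (1 - of_real x)"
      using False Ln_of_real[of x] by (cases "x = 1") (simp_all add: Arg_eq_Im_Ln)
    ultimately show ?thesis by simp
  qed
  finally show ?thesis
    using False by (simp add: Bloch_Wigner_def)
qed

lemma Bloch_Wigner_cnj: "Bloch_Wigner (cnj z) = - Bloch_Wigner z"
proof (cases "z \<in> \<real>")
  case True
  then show ?thesis by (auto simp: Reals_cnj_iff[symmetric] Bloch_Wigner_real elim!: Reals_cases)
next
  case False
  then have im: "Im z \<noteq> 0" by (simp add: complex_is_Real_iff)
  then have s: "z \<in> slit_plane" "z \<noteq> 1" "cnj z \<noteq> 1" by (auto simp: mem_slit_plane_iff)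
  then have "Ln (1 - cnj z) = cnj (Ln (1 - z))"
    using cnj_Ln[of "1 - z"] by (simp add: slit_plane_def)
  then show ?thesis
    using s by (simp add: Bloch_Wigner_eq_log_primitive log_primitive_cnj)
qed

text \<open>On the plane without the rays \<open>(-\<infinity>, 0]\<close> and \<open>[1, \<infinity>)\<close> the sum of both values has differential zero
and vanishes at \<open>1/2\<close>; on the real axis both values vanish.\<close>

lemma Bloch_Wigner_1_minus: "Bloch_Wigner (1 - z) = - Bloch_Wigner z"
proof (cases "Im z = 0")
  case True
  then obtain x where "z = of_real x" by (metis complex_is_Real_iff Reals_cases)
  then show ?thesis
    using Bloch_Wigner_real[of x] Bloch_Wigner_real[of "1 - x"] by simp
next
  case False
  let ?S = "slit_plane \<inter> {z. 1 - z \<in> slit_plane}"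
  let ?f = "\<lambda>z. Bloch_Wigner (1 - z) + Bloch_Wigner z"
  have S: "?S = slit_plane \<inter> ({z. Im z \<noteq> 0} \<union> {z. Re z > 0})"
    by (auto simp: mem_slit_plane_iff)
  have half: "(1 / 2 :: complex) \<in> ?S" by (simp add: mem_slit_plane_iff)
  have zS: "z \<in> ?S" using False by (simp add: mem_slit_plane_iff)
  have "starlike ?S"
    unfolding starlike_def
  proof (rule bexI[OF _ half], rule ballI)
    fix w assume w: "w \<in> ?S"
    show "closed_segment (1 / 2) w \<subseteq> ?S"
    proof
      fix v assume "v \<in> closed_segment (1 / 2) w"
      then obtain u where u: "0 \<le> u" "u \<le> 1" "v = (1 - u) *\<^sub>R (1 / 2) + u *\<^sub>R w" by (auto simp: in_segment)
      show "v \<in> ?S"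
      proof (cases "u = 0 \<or> Im w \<noteq> 0")
        case False
        then have "0 < Re w" "Re w < 1" using w by (auto simp: mem_slit_plane_iff)
        moreover have "0 < u" using False u by simp
        ultimately have "0 < u * Re w" "u * Re w < u" by simp_all
        moreover have "Re v = (1 - u) / 2 + u * Re w" using u by simp
        ultimately have "0 < Re v" "Re v < 1" using u(2) by (auto simp: field_simps)
        then show ?thesis by (simp add: mem_slit_plane_iff)
      qed (use u in \<open>auto simp: mem_slit_plane_iff\<close>)
    qed
  qed
  then have conn: "connected ?S" by (rule starlike_imp_connected)
  have opn: "open ?S"
    unfolding S by (intro open_Int open_Un open_Collect_neq open_Collect_less continuous_intros open_slit_plane)
  have der: "(?f has_derivative (\<lambda>h. 0)) (at w)" if w: "w \<in> ?S" for w
  proof -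
    have ws: "w \<in> slit_plane" "1 - w \<in> slit_plane" "w \<noteq> 0" "1 - w \<noteq> 0"
      using w by (auto simp: mem_slit_plane_iff)
    have "((\<lambda>z. 1 - z) has_derivative (\<lambda>h. - h)) (at w)"
      by (auto intro!: derivative_eq_intros)
    from has_derivative_compose[OF this has_derivative_Bloch_Wigner_slit[OF ws(2,4)]]
    have "((\<lambda>z. Bloch_Wigner (1 - z)) has_derivative (\<lambda>h. Bloch_Wigner_differential (1 - w) (- h))) (at w)" .
    from has_derivative_add[OF this has_derivative_Bloch_Wigner_slit[OF ws(1,3)]]
    show ?thesis by (simp add: Bloch_Wigner_differential_def)
  qed
  have "?f z = ?f (1 / 2)"
    using has_derivative_zero_unique_connected[OF opn conn, of ?f] der zS half by blast
  also have "\<dots> = 0"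
    using Bloch_Wigner_real[of "1 / 2"] by simp
  finally show ?thesis by simp
qed

text \<open>The function is smooth across the cut as well: there the reflection formula expresses it by its
values near the negative real axis.\<close>

lemma has_derivative_Bloch_Wigner:
  assumes "z \<noteq> 0" "z \<noteq> 1"
  shows "(Bloch_Wigner has_derivative Bloch_Wigner_differential z) (at z)"
proof (cases "z \<in> slit_plane")
  case False
  then have s: "1 - z \<in> slit_plane" "1 - z \<noteq> 0" using assms by (auto simp: mem_slit_plane_iff)
  have "((\<lambda>z. 1 - z) has_derivative (\<lambda>h. - h)) (at z)"
    by (auto intro!: derivative_eq_intros)
  from has_derivative_compose[OF this has_derivative_Bloch_Wigner_slit[OF s]]
  have "((\<lambda>z. - Bloch_Wigner (1 - z)) has_derivative (\<lambda>h. - Bloch_Wigner_differential (1 - z) (- h))) (at z)"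
    by (rule has_derivative_minus)
  moreover have "(\<lambda>h. - Bloch_Wigner_differential (1 - z) (- h)) = Bloch_Wigner_differential z"
    by (simp add: fun_eq_iff Bloch_Wigner_differential_def)
  ultimately show ?thesis by (simp add: Bloch_Wigner_1_minus)
qed (rule has_derivative_Bloch_Wigner_slit[OF _ assms(1)])

lemma isCont_Bloch_Wigner: "isCont Bloch_Wigner z"
proof -
  have "isCont (\<lambda>z. - Bloch_Wigner (1 - z)) 1"
    by (rule isCont_minus, rule isCont_o2[where g = Bloch_Wigner])
      (simp_all add: isCont_Bloch_Wigner_0)
  then have "isCont Bloch_Wigner 1" by (simp add: Bloch_Wigner_1_minus)
  then show ?thesis
    using isCont_Bloch_Wigner_0 has_derivative_continuous[OF has_derivative_Bloch_Wigner, of z]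
    by (cases "z = 0 \<or> z = 1") auto
qed


section \<open>The five-term relation of the Bloch-Wigner function\<close>

text \<open>Here \<open>p\<close> and \<open>q\<close> are the logarithmic derivatives of \<open>g\<close> and of \<open>1 - g\<close>.\<close>

lemma has_derivative_Bloch_Wigner_compose:
  assumes g: "(g has_field_derivative g') (at x)" and "g x \<noteq> 0" "g x \<noteq> 1"
    and p: "p * g x = g'" and q: "q * (1 - g x) = - g'"
  shows "((\<lambda>x. Bloch_Wigner (g x)) has_derivative
     (\<lambda>h. ln (cmod (g x)) * Im (q * h) - ln (cmod (1 - g x)) * Im (p * h))) (at x)"
proof -
  have "((\<lambda>x. Bloch_Wigner (g x)) has_derivative (\<lambda>h. Bloch_Wigner_differential (g x) (g' * h))) (at x)"
    using has_derivative_compose[OF g[unfolded has_field_derivative_def] has_derivative_Bloch_Wigner] assms(2,3)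
    by simp
  moreover have "Bloch_Wigner_differential (g x) (g' * h) = ln (cmod (g x)) * Im (q * h) - ln (cmod (1 - g x)) * Im (p * h)" for h
  proof -
    have "- (g' * h) / (1 - g x) = q * h" "g' * h / g x = p * h"
      using assms(2,3) q by (simp_all add: divide_simps mult.assoc mult.left_commute mult.commute flip: p)
    then show ?thesis unfolding Bloch_Wigner_differential_def by simp
  qed
  ultimately show ?thesis by simp
qed

text \<open>For fixed \<open>y\<close> the sum is a continuous function of \<open>x\<close> on the connected set of \<open>x \<noteq> 0, 1\<close>.  Off the
point \<open>y\<close> its differential vanishes: the logarithms of the five arguments, and of their differences from \<open>1\<close>, are
integral combinations of those of \<open>x\<close>, \<open>1 - x\<close>, \<open>y\<close>, \<open>1 - y\<close> and \<open>x - y\<close>.  At \<open>x = y\<close> the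
sum is \<open>D(1) - D(1) + D(1) = 0\<close>.\<close>

lemma Bloch_Wigner_five_term:
  assumes x: "x \<noteq> 0" "x \<noteq> 1" and y: "y \<noteq> 0" "y \<noteq> 1"
  shows "Bloch_Wigner x - Bloch_Wigner y + Bloch_Wigner (y / x)
    - Bloch_Wigner ((1 - inverse x) / (1 - inverse y)) + Bloch_Wigner ((1 - x) / (1 - y)) = 0"
proof -
  let ?F = "\<lambda>x. Bloch_Wigner x - Bloch_Wigner y + Bloch_Wigner (y / x)
    - Bloch_Wigner ((1 - inverse x) / (1 - inverse y)) + Bloch_Wigner ((1 - x) / (1 - y))"
  have y': "1 - y \<noteq> 0" "1 - inverse y \<noteq> 0" using y by auto
  have der: "(?F has_derivative (\<lambda>h. 0)) (at x within UNIV - {0, 1})" if "x \<in> UNIV - {0, 1} - {y}" for x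
  proof -
    have nz: "x \<noteq> 0" "x - 1 \<noteq> 0" "1 - x \<noteq> 0" "x - y \<noteq> 0" "y - x \<noteq> 0" "x \<noteq> y" using that by auto
    \<comment> \<open>the logarithmic derivatives of \<open>x\<close>, \<open>1 - x\<close> and \<open>x - y\<close>\<close>
    let ?A = "1 / x" and ?B = "1 / (x - 1)" and ?E = "1 / (x - y)"
    let ?g3 = "\<lambda>x. (1 - inverse x) / (1 - inverse y)"
    have eqs: "1 - y / x = (x - y) / x" "?g3 x = y * (1 - x) / (x * (1 - y))"
      "1 - ?g3 x = (x - y) / (x * (1 - y))" "1 - (1 - x) / (1 - y) = (x - y) / (1 - y)"
      using nz y y' by (simp_all add: field_simps)
    have 1: "((\<lambda>x. Bloch_Wigner x) has_derivative
        (\<lambda>h. ln (cmod x) * Im (?B * h) - ln (cmod (1 - x)) * Im (?A * h))) (at x)"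
      using nz by (intro has_derivative_Bloch_Wigner_compose[where g = "\<lambda>x. x" and g' = 1])
        (auto simp: field_simps)
    have 2: "((\<lambda>x. Bloch_Wigner (y / x)) has_derivative
        (\<lambda>h. ln (cmod (y / x)) * Im ((?E - ?A) * h) - ln (cmod (1 - y / x)) * Im ((- ?A) * h))) (at x)"
      using nz y by (intro has_derivative_Bloch_Wigner_compose[where g' = "- y / x\<^sup>2"])
        (auto intro!: derivative_eq_intros simp: field_simps power2_eq_square)
    have 3: "((\<lambda>x. Bloch_Wigner (?g3 x)) has_derivative
        (\<lambda>h. ln (cmod (?g3 x)) * Im ((?E - ?A) * h) - ln (cmod (1 - ?g3 x)) * Im ((?B - ?A) * h))) (at x)"
    proof (rule has_derivative_Bloch_Wigner_compose)
      show "(?g3 has_field_derivative 1 / x\<^sup>2 / (1 - inverse y)) (at x)"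
        by (intro DERIV_cdivide) (use nz in \<open>auto intro!: derivative_eq_intros simp: field_simps power2_eq_square\<close>)
      show "(?B - ?A) * ?g3 x = 1 / x\<^sup>2 / (1 - inverse y)"
      proof -
        have "(?B - ?A) * (1 - inverse x) = 1 / x\<^sup>2"
          using nz by (simp add: divide_simps power2_eq_square; simp add: algebra_simps)
        then show ?thesis by (simp only: times_divide_eq_right)
      qed
      have "1 / x\<^sup>2 / (1 - inverse y) = y / (x\<^sup>2 * (y - 1))"
        using nz y y' by (simp add: field_simps)
      also have "- \<dots> = (?E - ?A) * ((x - y) / (x * (1 - y)))"
        using nz y y' by (simp add: divide_simps power2_eq_square; simp add: algebra_simps)
      finally show "(?E - ?A) * (1 - ?g3 x) = - (1 / x\<^sup>2 / (1 - inverse y))"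
        by (simp only: eqs(3))
      show "?g3 x \<noteq> 0" unfolding eqs(2) using nz y y' by simp
      show "?g3 x \<noteq> 1" using eqs(3) nz y y' by auto
    qed
    have 4: "((\<lambda>x. Bloch_Wigner ((1 - x) / (1 - y))) has_derivative
        (\<lambda>h. ln (cmod ((1 - x) / (1 - y))) * Im (?E * h) - ln (cmod (1 - (1 - x) / (1 - y))) * Im (?B * h))) (at x)"
    proof (rule has_derivative_Bloch_Wigner_compose)
      show "((\<lambda>x. (1 - x) / (1 - y)) has_field_derivative - 1 / (1 - y)) (at x)"
        by (intro DERIV_cdivide) (auto intro!: derivative_eq_intros)
      have "?B * (1 - x) = - 1" using nz by (simp add: field_simps)
      then show "?B * ((1 - x) / (1 - y)) = - 1 / (1 - y)" by (simp only: times_divide_eq_right)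
      show "?E * (1 - (1 - x) / (1 - y)) = - (- 1 / (1 - y))"
        unfolding eqs(4) using nz by simp
      show "(1 - x) / (1 - y) \<noteq> 0" using nz y' by simp
      show "(1 - x) / (1 - y) \<noteq> 1" using eqs(4) nz y' by auto
    qed
    have "(?F has_derivative (\<lambda>h. 0)) (at x)"
    proof (rule has_derivative_eq_rhs)
      show "(?F has_derivative (\<lambda>h. (ln (cmod x) * Im (?B * h) - ln (cmod (1 - x)) * Im (?A * h)) - 0
        + (ln (cmod (y / x)) * Im ((?E - ?A) * h) - ln (cmod (1 - y / x)) * Im ((- ?A) * h))
        - (ln (cmod (?g3 x)) * Im ((?E - ?A) * h) - ln (cmod (1 - ?g3 x)) * Im ((?B - ?A) * h))
        + (ln (cmod ((1 - x) / (1 - y))) * Im (?E * h) - ln (cmod (1 - (1 - x) / (1 - y))) * Im (?B * h)))) (at x)"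
        by (intro has_derivative_add has_derivative_diff has_derivative_const 1 2 3 4)
      \<comment> \<open>Here \<open>a\<close>, \<open>b\<close>, \<open>c\<close>, \<open>d\<close>, \<open>e\<close> stand for the logarithms of the absolute values of \<open>x\<close>, \<open>1 - x\<close>, \<open>y\<close>, \<open>1 - y\<close>, \<open>x - y\<close>, and \<open>IA\<close>, \<open>IB\<close>, \<open>IE\<close> for the differentials of the arguments of \<open>x\<close>, \<open>1 - x\<close>, \<open>x - y\<close>.\<close>
      have abs: "a * IB - b * IA - 0 + (((c - a) * (IE - IA)) - (e - a) * (- IA))
          - ((c + b - (a + d)) * (IE - IA) - (e - (a + d)) * (IB - IA))
          + ((b - d) * IE - (e - d) * IB) = 0" for a b c d e IA IB IE :: real
        by (simp add: algebra_simps)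
      show "(\<lambda>h. (ln (cmod x) * Im (?B * h) - ln (cmod (1 - x)) * Im (?A * h)) - 0
        + (ln (cmod (y / x)) * Im ((?E - ?A) * h) - ln (cmod (1 - y / x)) * Im ((- ?A) * h))
        - (ln (cmod (?g3 x)) * Im ((?E - ?A) * h) - ln (cmod (1 - ?g3 x)) * Im ((?B - ?A) * h))
        + (ln (cmod ((1 - x) / (1 - y))) * Im (?E * h) - ln (cmod (1 - (1 - x) / (1 - y))) * Im (?B * h))) = (\<lambda>h. 0)"
      proof
        fix h
        have l: "ln (cmod (y / x)) = ln (cmod y) - ln (cmod x)"
          "ln (cmod (1 - y / x)) = ln (cmod (x - y)) - ln (cmod x)"
          "ln (cmod (?g3 x)) = ln (cmod y) + ln (cmod (1 - x)) - (ln (cmod x) + ln (cmod (1 - y)))"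
          "ln (cmod (1 - ?g3 x)) = ln (cmod (x - y)) - (ln (cmod x) + ln (cmod (1 - y)))"
          "ln (cmod ((1 - x) / (1 - y))) = ln (cmod (1 - x)) - ln (cmod (1 - y))"
          "ln (cmod (1 - (1 - x) / (1 - y))) = ln (cmod (x - y)) - ln (cmod (1 - y))"
          unfolding eqs(1,3,4) unfolding eqs(2) using nz y y' by (simp_all add: norm_mult norm_divide ln_mult ln_div)
        have i: "Im ((?E - ?A) * h) = Im (?E * h) - Im (?A * h)" "Im ((?B - ?A) * h) = Im (?B * h) - Im (?A * h)"
          "Im ((- ?A) * h) = - Im (?A * h)"
          by (simp_all only: left_diff_distrib minus_complex.sel minus_mult_left[symmetric] uminus_complex.sel)
        show "(ln (cmod x) * Im (?B * h) - ln (cmod (1 - x)) * Im (?A * h)) - 0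
        + (ln (cmod (y / x)) * Im ((?E - ?A) * h) - ln (cmod (1 - y / x)) * Im ((- ?A) * h))
        - (ln (cmod (?g3 x)) * Im ((?E - ?A) * h) - ln (cmod (1 - ?g3 x)) * Im ((?B - ?A) * h))
        + (ln (cmod ((1 - x) / (1 - y))) * Im (?E * h) - ln (cmod (1 - (1 - x) / (1 - y))) * Im (?B * h)) = 0"
          unfolding l i by (rule abs)
      qed
    qed
    then show ?thesis by (rule has_derivative_at_withinI)
  qed
  have cont: "continuous_on (UNIV - {0, 1}) ?F"
  proof (rule continuous_at_imp_continuous_on, rule ballI)
    fix x :: complex assume "x \<in> UNIV - {0, 1}"
    then have x: "x \<noteq> 0" "x \<noteq> 1" by auto
    have c: "isCont (\<lambda>x. Bloch_Wigner (g x)) x" if "isCont g x" for g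
      using isCont_o2[where g = Bloch_Wigner, OF that isCont_Bloch_Wigner] .
    have "isCont (\<lambda>x. Bloch_Wigner (y / x)) x"
      by (rule c) (use x in \<open>auto intro!: continuous_intros\<close>)
    moreover have "isCont (\<lambda>x. Bloch_Wigner ((1 - inverse x) / (1 - inverse y))) x"
      by (rule c) (use x y' in \<open>auto intro!: continuous_intros\<close>)
    moreover have "isCont (\<lambda>x. Bloch_Wigner ((1 - x) / (1 - y))) x"
      by (rule c) (use x y' in \<open>auto intro!: continuous_intros\<close>)
    ultimately show "isCont ?F x"
      by (intro isCont_add isCont_diff isCont_Bloch_Wigner continuous_const)
  qed
  have Fy: "?F y = 0"
    using y y' Bloch_Wigner_real[of 1] by simp
  show ?thesis
  proof (rule has_derivative_zero_unique_strong_connected[OF _ _ _ cont, where K = "{y}" and c = y])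
    show "connected (UNIV - {0, 1 :: complex})"
      by (intro connected_open_delete_finite) auto
  qed (use x y der Fy in \<open>auto intro!: open_Diff\<close>)
qed


section \<open>The Bloch-Wigner function on the pre-Bloch group\<close>

lemma Bloch_Wigner_frag_superset:
  assumes "finite S" "Poly_Mapping.keys c \<subseteq> S"
  shows "Bloch_Wigner_frag c = (\<Sum>x\<in>S. of_int (Poly_Mapping.lookup c x) * Bloch_Wigner x)"
  unfolding Bloch_Wigner_frag_def
  using assms by (intro sum.mono_neutral_left) (auto simp: in_keys_iff)

lemma Bloch_Wigner_frag_add: "Bloch_Wigner_frag (a + b) = Bloch_Wigner_frag a + Bloch_Wigner_frag b"
proof -
  let ?S = "Poly_Mapping.keys a \<union> Poly_Mapping.keys b"
  have "Poly_Mapping.keys (a + b) \<subseteq> ?S" by (rule Poly_Mapping.keys_add)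
  then show ?thesis
    by (simp add: Bloch_Wigner_frag_superset[of ?S] lookup_add distrib_right sum.distrib)
qed

lemma Bloch_Wigner_frag_minus: "Bloch_Wigner_frag (- a) = - Bloch_Wigner_frag a"
  by (simp add: Bloch_Wigner_frag_def sum_negf)

lemma Bloch_Wigner_frag_diff: "Bloch_Wigner_frag (a - b) = Bloch_Wigner_frag a - Bloch_Wigner_frag b"
  using Bloch_Wigner_frag_add[of a "- b"] by (simp add: Bloch_Wigner_frag_minus)

lemma Bloch_Wigner_frag_of: "Bloch_Wigner_frag (frag_of x) = Bloch_Wigner x"
  by (simp add: Bloch_Wigner_frag_def)

lemma Bloch_Wigner_frag_five_term:
  assumes "x \<in> UNIV - {0, 1}" "y \<in> UNIV - {0, 1}"
  shows "Bloch_Wigner_frag (five_term x y) = 0"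
  unfolding five_term_def Bloch_Wigner_frag_add Bloch_Wigner_frag_diff Bloch_Wigner_frag_of
  using assms by (intro Bloch_Wigner_five_term) auto

lemma Bloch_Wigner_frag_subgroup:
  "c \<in> five_term_subgroup \<Longrightarrow> Bloch_Wigner_frag c = 0"
proof (induction rule: five_term_subgroup_induct)
  case zero
  then show ?case by (simp add: Bloch_Wigner_frag_def)
next
  case (add a b)
  then show ?case by (simp add: Bloch_Wigner_frag_add)
next
  case (five_term x y)
  then show ?case using Bloch_Wigner_frag_five_term by simp
next
  case (minus_five_term x y)
  then show ?case using Bloch_Wigner_frag_five_term[of x y] by (simp add: Bloch_Wigner_frag_minus)
qed

lemma Bloch_Wigner_frag_conj: "Bloch_Wigner_frag (conj_frag c) = - Bloch_Wigner_frag c"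
proof -
  have "Poly_Mapping.keys c \<subseteq> UNIV" by simp
  then show ?thesis
  proof (induction c rule: frag_induction)
    case (diff a b)
    then show ?case by (simp add: conj_frag_simps Bloch_Wigner_frag_diff)
  qed (simp_all add: conj_frag_simps Bloch_Wigner_frag_of Bloch_Wigner_cnj Bloch_Wigner_frag_def)
qed

text \<open>The image of the coset is a singleton, so its element is well defined.\<close>

lemma Bloch_Wigner_class_eq:
  "Bloch_Wigner_class (pre_Bloch_class c) = Bloch_Wigner_frag c"
proof -
  have "pre_Bloch_class c = (\<lambda>r. r + c) ` five_term_subgroup"
    by (auto simp: pre_Bloch_class_def r_coset_def frag_group_def)
  then have "Bloch_Wigner_frag ` pre_Bloch_class c = (\<lambda>r. Bloch_Wigner_frag c) ` five_term_subgroup"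
    by (simp add: image_image Bloch_Wigner_frag_add Bloch_Wigner_frag_subgroup)
  also have "\<dots> = {Bloch_Wigner_frag c}" using five_term_subgroup_0 by auto
  finally show ?thesis by (simp add: Bloch_Wigner_class_def)
qed

text \<open>Conjugation changes the sign of the Bloch-Wigner function.\<close>

lemma Bloch_Wigner_class_conj_invariant:
  assumes "pre_Bloch_class (conj_frag c) = pre_Bloch_class c"
  shows "Bloch_Wigner_class (pre_Bloch_class c) = 0"
  using Bloch_Wigner_class_eq[of c] Bloch_Wigner_class_eq[of "conj_frag c"] Bloch_Wigner_frag_conj[of c] assms
  by simp


section \<open>Invariance under conjugation\<close>

definition edge_chain :: "edge_coords \<Rightarrow> nat \<Rightarrow> (complex \<Rightarrow>\<^sub>0 int)" where
  "edge_chain z \<nu> = frag_of (z \<nu> 1 2) + frag_of (z \<nu> 2 1) + frag_of (z \<nu> 3 4) + frag_of (z \<nu> 4 3)"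

lemma beta_edge_chain: "beta K z = pre_Bloch_class (\<Sum>\<nu>\<in>simplices K. edge_chain z \<nu>)"
  by (simp add: beta_def edge_chain_def)

lemma edge_chain_conj_decoration:
  "edge_chain (coords (conj_decoration T)) \<nu> = conj_frag (edge_chain (coords T) \<nu>)"
proof -
  have "z_edge (conj_decoration T \<nu>) i j = cnj (z_edge (T \<nu>) i j)" if "even_order i j k l" for i j k l
    unfolding conj_decoration_def by (rule z_edge_conj[OF that])
  then have "z_edge (conj_decoration T \<nu>) 1 2 = cnj (z_edge (T \<nu>) 1 2)"
    "z_edge (conj_decoration T \<nu>) 2 1 = cnj (z_edge (T \<nu>) 2 1)"
    "z_edge (conj_decoration T \<nu>) 3 4 = cnj (z_edge (T \<nu>) 3 4)"
    "z_edge (conj_decoration T \<nu>) 4 3 = cnj (z_edge (T \<nu>) 4 3)"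
    by (auto simp: even_order_iff)
  then show ?thesis
    by (simp only: edge_chain_def coords_def conj_frag_simps)
qed

lemma conj_frag_sum: "conj_frag (sum f A) = (\<Sum>a\<in>A. conj_frag (f a))"
  by (induction A rule: infinite_finite_induct) (simp_all add: conj_frag_simps)

theorem theorem5p2:
  fixes K :: face_gluing and T :: decoration
  assumes "ideal_triangulation K"
    and "no_boundary_faces K"
    and "CR_decoration K T"
    and "face_compatible K T"
  shows "beta K (coords T) = beta K (coords (conj_decoration T))
    \<and> beta K (coords T) \<in> pre_Bloch_plus
    \<and> tri_volume K (coords T) = 0"
proof -
  define c where "c = (\<Sum>\<nu>\<in>simplices K. edge_chain (coords T) \<nu>)"
  have beta: "beta K (coords T) = pre_Bloch_class c" 
    and beta_conj: "beta K (coords (conj_decoration T)) = pre_Bloch_class (conj_frag c)"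
    by (simp_all add: c_def beta_edge_chain edge_chain_conj_decoration conj_frag_sum)
  have CR: "spherical_CR_tetrahedron (T \<nu>)" if "\<nu> \<in> simplices K" for \<nu>
    using assms(3) that by (simp add: CR_decoration_def)
  have edges: "{coords T \<nu> 1 2, coords T \<nu> 2 1, coords T \<nu> 3 4, coords T \<nu> 4 3} \<inter> {0, 1} = {}"
    if "\<nu> \<in> simplices K" for \<nu>
    using CR_tetrahedron_conj_difference(1)[OF CR[OF that]] by (simp add: coords_def)
  have "abs_bloch (edge_chain (coords T) \<nu>) - abs_bloch (conj_frag (edge_chain (coords T) \<nu>))
      = - (\<Sum>v\<in>UNIV. face_bracket (T \<nu>) v)" if \<nu>: "\<nu> \<in> simplices K" for \<nu>
  proof -
    have br: "abs_bloch (frag_of z) = bracket z" if "z \<noteq> 1" for z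
      using that by (simp add: bracket_def)
    have cnj1: "cnj z \<noteq> 1" if "z \<noteq> 1" for z using that by (metis complex_cnj_cnj complex_cnj_one)
    show ?thesis
      using edges[OF \<nu>] CR_tetrahedron_conj_difference(2)[OF CR[OF \<nu>]]
      by (simp add: edge_chain_def coords_def conj_frag_simps abs_bloch_simps br cnj1)
  qed
  then have "abs_bloch c - abs_bloch (conj_frag c) = - (\<Sum>\<nu>\<in>simplices K. \<Sum>v\<in>UNIV. face_bracket (T \<nu>) v)"
    by (simp add: c_def conj_frag_sum abs_bloch_sum flip: sum_subtractf sum_negf)
  also have "\<dots> = 0" using sum_face_brackets[OF assms(1,2,4)] by simp
  finally have "abs_bloch c = abs_bloch (conj_frag c)" by simp
  then have eq: "pre_Bloch_class c = pre_Bloch_class (conj_frag c)" by (simp add: pre_Bloch_class_eq_iff)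
  have "c \<in> carrier frag_group"
  proof -
    have of: "frag_of z \<in> carrier frag_group" if "z \<noteq> 0" "z \<noteq> 1" for z
      using that by (simp add: frag_group_def)
    have add: "a + b \<in> carrier frag_group" if "a \<in> carrier frag_group" "b \<in> carrier frag_group" for a b
      using that Poly_Mapping.keys_add[of a b] by (auto simp: frag_group_def)
    have "edge_chain (coords T) \<nu> \<in> carrier frag_group" if "\<nu> \<in> simplices K" for \<nu>
      unfolding edge_chain_def using edges[OF that] by (intro add of) auto
    then show ?thesis
      unfolding c_def frag_group_def by (intro sum_closed_free_Abelian_group) auto
  qed
  then have "pre_Bloch_class c \<in> carrier pre_Bloch"
    by (auto simp: pre_Bloch_def FactGroup_def RCOSETS_def pre_Bloch_class_def)
  moreover have "tau (pre_Bloch_class c) = pre_Bloch_class c" by (simp only: tau_class eq[symmetric])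
  ultimately have "beta K (coords T) \<in> pre_Bloch_plus" by (simp add: beta pre_Bloch_plus_def)
  moreover have "tri_volume K (coords T) = 0"
    using Bloch_Wigner_class_conj_invariant[OF eq[symmetric]] by (simp add: tri_volume_def beta)
  ultimately show ?thesis using eq unfolding beta beta_conj by blast
qed

end
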